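(* Let $\Omega\subset\mathbb{R}^2$ be a simply connected bounded Lipschitz domain with polygonal boundary, and let $\sigma\in L^\infty(\Omega)$ with $\sigma\ge 0$. Let $g:\mathbb{R}^2\to\mathbb{R}$ have gradient $g'=\nabla g\in C^1(\mathbb{R}^2)$ (with values in $\mathbb{R}^2$), and suppose there are constants $\alpha, C_a>0$ such that (i) $\langle g'(y)-g'(z),\,y-z\rangle\ge \alpha|y-z|^2$ for all $y,z\in\mathbb{R}^2$, (ii) $|g'(y)-g'(z)|\le C_a|y-z|$ for all $y,z\in\mathbb{R}^2$. Then for any $j\in L^2(\Omega)$ there exists a unique pair $(H,a)\in H(\operatorname{curl};\Omega)\times L^2(\Omega)$ such that $$(g'(H),v)-(a,\operatorname{curl} v)=0\qquad\forall v\in H(\operatorname{curl};\Omega),$$ $$(\operatorname{curl}H,q)+(\sigma a,q)=(j,q)\qquad\forall q\in L^2(\Omega),$$ and this solution satisfies $$\|H\|_{H(\operatorname{curl};\Omega)}+\|a\|_{L^2(\Omega)}\le C\,\|j\|_{L^2(\Omega)},$$ where the constant $C$ depends only on $\alpha$, $C_a$, and the domain $\Omega$.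
   Context: $(\cdot,\cdot)$ denotes the $L^2(\Omega)$ inner product of scalar functions or of vector fields. For a vector field $v=(v_x,v_y)$ on $\Omega\subset\mathbb{R}^2$, the scalar curl is $\operatorname{curl}v=\partial_y v_x-\partial_x v_y$ (in the distributional sense). $H(\operatorname{curl};\Omega)=\{v\in L^2(\Omega)^2:\operatorname{curl}v\in L^2(\Omega)\}$, with norm $\|v\|_{H(\operatorname{curl};\Omega)}^2=\|v\|_{L^2(\Omega)}^2+\|\operatorname{curl}v\|_{L^2(\Omega)}^2$; no boundary conditions are imposed on this space. For a vector field $H$, $g'(H)$ denotes the pointwise composition $x\mapsto g'(H(x))$. $\langle\cdot,\cdot\rangle$ and $|\cdot|$ are the Euclidean inner product and norm on $\mathbb{R}^2$.
   Formalization: The stated estimate fails if g'(0)≠0, and C cannot be uniform in σ. Proved instead, with C depending only on α, C_a, Ω: ‖H‖_{L²}+‖a‖_{L²} ≤ C(‖j‖+|g'(0)|) and ‖H‖_{H(curl)}+‖a‖_{L²} ≤ C(1+‖σ‖_∞^{1/2})(‖j‖+|g'(0)|). *)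

theory Defs
  imports "HOL-Analysis.Analysis"
begin

section \<open>Planar domains\<close>

text \<open>
  Near every boundary point the set is, in a suitable orthonormal frame (s, t), the part of a
  rectangle lying strictly above the graph of a Lipschitz function. For open sets this
  forces the frontier inside the rectangle to be the graph, so the set lies on one
  side of its boundary.
\<close>

definition lipschitz_boundary :: "(real^2) set \<Rightarrow> bool" where
  "lipschitz_boundary \<Omega> \<longleftrightarrow>
    (\<forall>p\<in>frontier \<Omega>. \<exists>e n r h L. \<exists>\<phi>::real \<Rightarrow> real.
       norm e = 1 \<and> norm n = 1 \<and> e \<bullet> n = 0 \<and> 0 < r \<and> 0 < h \<and> L-lipschitz_on {-r<..<r} \<phi> \<and>
       (\<forall>s t. \<bar>s\<bar> < r \<and> \<bar>t\<bar> < h \<longrightarrow> (p + s *\<^sub>R e + t *\<^sub>R n \<in> \<Omega> \<longleftrightarrow> \<phi> s < t)))"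

definition polygonal_boundary :: "(real^2) set \<Rightarrow> bool" where
  "polygonal_boundary \<Omega> \<longleftrightarrow>
    (\<exists>E. finite E \<and> frontier \<Omega> = (\<Union>(a, b)\<in>E. closed_segment a b))"

definition polygonal_lipschitz_domain :: "(real^2) set \<Rightarrow> bool" where
  "polygonal_lipschitz_domain \<Omega> \<longleftrightarrow>
    open \<Omega> \<and> connected \<Omega> \<and> \<Omega> \<noteq> {} \<and> bounded \<Omega> \<and> lipschitz_boundary \<Omega> \<and> polygonal_boundary \<Omega>"


section \<open>Lebesgue spaces\<close>

text \<open>
  Elements are functions rather than equivalence classes; equality in these spaces is
  equality almost everywhere with respect to \<^term>\<open>lebesgue_on \<Omega>\<close>, and values outside
  \<open>\<Omega>\<close> are irrelevant.
\<close>

definition L2 :: "(real^2) set \<Rightarrow> (real^2 \<Rightarrow> 'b::euclidean_space) set" where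
  "L2 \<Omega> = {f. f \<in> borel_measurable (lebesgue_on \<Omega>) \<and>
              integrable (lebesgue_on \<Omega>) (\<lambda>x. (norm (f x))\<^sup>2)}"

definition L2_inner ::
    "(real^2) set \<Rightarrow> (real^2 \<Rightarrow> 'b::euclidean_space) \<Rightarrow> (real^2 \<Rightarrow> 'b) \<Rightarrow> real" where
  "L2_inner \<Omega> f g = (LINT x|lebesgue_on \<Omega>. f x \<bullet> g x)"

definition L2_norm :: "(real^2) set \<Rightarrow> (real^2 \<Rightarrow> 'b::euclidean_space) \<Rightarrow> real" where
  "L2_norm \<Omega> f = sqrt (L2_inner \<Omega> f f)"

definition Linf :: "(real^2) set \<Rightarrow> (real^2 \<Rightarrow> real) set" where
  "Linf \<Omega> = {f. f \<in> borel_measurable (lebesgue_on \<Omega>) \<and>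
                (\<exists>M. AE x in lebesgue_on \<Omega>. \<bar>f x\<bar> \<le> M)}"

definition Linf_norm :: "(real^2) set \<Rightarrow> (real^2 \<Rightarrow> real) \<Rightarrow> real" where
  "Linf_norm \<Omega> f = Inf {M. 0 \<le> M \<and> (AE x in lebesgue_on \<Omega>. \<bar>f x\<bar> \<le> M)}"


section \<open>Classical smoothness and the distributional curl\<close>

definition partial_deriv ::
    "'n::finite \<Rightarrow> (real^'n \<Rightarrow> 'b::real_normed_vector) \<Rightarrow> real^'n \<Rightarrow> 'b" where
  "partial_deriv i f x = frechet_derivative f (at x) (axis i 1)"

primrec Ck :: "nat \<Rightarrow> (real^'n::finite \<Rightarrow> 'b::real_normed_vector) \<Rightarrow> bool" where
  "Ck 0 f \<longleftrightarrow> continuous_on UNIV f"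
| "Ck (Suc k) f \<longleftrightarrow> (\<forall>x. f differentiable (at x)) \<and> (\<forall>i. Ck k (partial_deriv i f))"

definition test_function :: "(real^2) set \<Rightarrow> (real^2 \<Rightarrow> real) \<Rightarrow> bool" where
  "test_function \<Omega> \<phi> \<longleftrightarrow> (\<forall>k. Ck k \<phi>) \<and>
     compact (closure {x. \<phi> x \<noteq> 0}) \<and> closure {x. \<phi> x \<noteq> 0} \<subseteq> \<Omega>"

text \<open>
  The sign convention is curl v = (d/dy) v_x - (d/dx) v_y; moving the derivatives to the test
  function changes both signs.
\<close>

definition has_weak_curl :: "(real^2) set \<Rightarrow> (real^2 \<Rightarrow> real^2) \<Rightarrow> (real^2 \<Rightarrow> real) \<Rightarrow> bool" where
  "has_weak_curl \<Omega> v w \<longleftrightarrow>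
    (\<forall>\<phi>. test_function \<Omega> \<phi> \<longrightarrow>
       (LINT x|lebesgue_on \<Omega>. w x * \<phi> x) =
       (LINT x|lebesgue_on \<Omega>. v x $ 2 * partial_deriv 1 \<phi> x - v x $ 1 * partial_deriv 2 \<phi> x))"

definition Hcurl :: "(real^2) set \<Rightarrow> (real^2 \<Rightarrow> real^2) set" where
  "Hcurl \<Omega> = {v \<in> L2 \<Omega>. \<exists>w\<in>L2 \<Omega>. has_weak_curl \<Omega> v w}"

text \<open>A representative; it is determined only up to equality almost everywhere in \<open>\<Omega>\<close>.\<close>

definition curl :: "(real^2) set \<Rightarrow> (real^2 \<Rightarrow> real^2) \<Rightarrow> real^2 \<Rightarrow> real" where
  "curl \<Omega> v = (SOME w. w \<in> L2 \<Omega> \<and> has_weak_curl \<Omega> v w)"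

definition Hcurl_norm :: "(real^2) set \<Rightarrow> (real^2 \<Rightarrow> real^2) \<Rightarrow> real" where
  "Hcurl_norm \<Omega> v = sqrt ((L2_norm \<Omega> v)\<^sup>2 + (L2_norm \<Omega> (curl \<Omega> v))\<^sup>2)"


section \<open>The mixed variational problem\<close>

definition mixed_solution ::
    "(real^2) set \<Rightarrow> (real^2 \<Rightarrow> real) \<Rightarrow> (real^2 \<Rightarrow> real^2) \<Rightarrow> (real^2 \<Rightarrow> real) \<Rightarrow>
     (real^2 \<Rightarrow> real^2) \<Rightarrow> (real^2 \<Rightarrow> real) \<Rightarrow> bool" where
  "mixed_solution \<Omega> \<sigma> g' j H a \<longleftrightarrow>
     H \<in> Hcurl \<Omega> \<and> a \<in> L2 \<Omega> \<and>
     (\<forall>v\<in>Hcurl \<Omega>. L2_inner \<Omega> (\<lambda>x. g' (H x)) v - L2_inner \<Omega> a (curl \<Omega> v) = 0) \<and>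
     (\<forall>q\<in>L2 \<Omega>. L2_inner \<Omega> (curl \<Omega> H) q + L2_inner \<Omega> (\<lambda>x. \<sigma> x * a x) q = L2_inner \<Omega> j q)"

end

theory Submission
  imports Defs
begin

text \<open>
  Write \<open>(H, a)\<close> for a solution and \<open>h = g' (H)\<close>. The first equation of the mixed problem says that
  \<open>a\<close> lies in the domain of the Hilbert space adjoint of curl and is mapped to \<open>h\<close> (\<open>curl_adjoint\<close>),
  the second that \<open>curl H = j - \<sigma> a\<close> (\<open>mixed_solution_iff\<close>). As \<open>g'\<close> is strongly monotone and
  Lipschitz, it has an inverse \<open>f\<close> with the same two properties, so that \<open>H = f h\<close> can be
  eliminated. What remains is to find \<open>(h, a)\<close> in the graph of the adjoint of curl with
  \<open>(f h, k) + (\<sigma> a - j, b) = 0\<close> for all \<open>(k, b)\<close> in this graph. The graph is a closed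
  subspace of \<open>L\<^sup>2\<close>, and such a variational equation has a solution as soon as its operator is
  strongly monotone and Lipschitz there (\<open>monotone_equation_solvable\<close>). Inserting
  \<open>(k, b) = (perp_grad \<phi>, \<phi>)\<close> for test functions \<open>\<phi>\<close> recovers \<open>curl (f h) = j - \<sigma> a\<close>.

  Strong monotonicity, uniqueness and the estimates all rest on the inequality
  \<open>\<parallel>a\<parallel> \<le> c \<parallel>h\<parallel>\<close> on this graph (\<open>curl_adjoint_Poincare\<close>), which is dual to the existence of a
  bounded right inverse of curl (\<open>curl_bounded_right_inverse\<close>). The latter is explicit: extend the
  given function by zero and take its antiderivative in the second coordinate as the first component
  of the field, with second component zero. Testing the first equation with \<open>H\<close>, or with the
  difference of two solutions, then gives the estimates and uniqueness.

  Two pieces of general theory support this. Completeness of \<open>L\<^sup>2\<close> (Riesz--Fischer) is the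
  \<open>complete_space\<close> instance of the type \<open>l2\<close>. That the weak curl is unique up to null sets, so that
  the representative chosen by \<open>curl\<close> does not matter, is the fundamental lemma of the calculus of
  variations, for which smooth bump functions are constructed from \<open>exp (-1/t)\<close>.
\<close>


section \<open>Strongly monotone equations in Hilbert spaces\<close>

text \<open>
  A minimising sequence for the distance from \<open>x\<close> to \<open>W\<close> converges by completeness, and
  minimality of its limit along every line through it in \<open>W\<close> is orthogonality.
\<close>

lemma orthogonal_projection_exists:
  fixes W :: "'h::real_inner set"
  assumes sub: "subspace W" and com: "complete W"
  shows "\<exists>p\<in>W. \<forall>k\<in>W. (x - p) \<bullet> k = 0"
proof -
  define d where "d = infdist x W"
  have W0: "0 \<in> W" "W \<noteq> {}" using sub subspace_0 by auto
  have d0: "0 \<le> d" by (simp add: d_def infdist_nonneg)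
  have dle: "d\<^sup>2 \<le> (norm (x - y))\<^sup>2" if "y \<in> W" for y
    using infdist_le[OF that, of x] d0 by (auto simp: d_def dist_norm intro!: power_mono)
  have "\<exists>y\<in>W. (norm (x - y))\<^sup>2 < d\<^sup>2 + inverse (real (Suc n))" for n
  proof -
    have "d < sqrt (d\<^sup>2 + inverse (real (Suc n)))"
      by (rule real_less_rsqrt) simp
    then obtain y where "y \<in> W" "dist x y < sqrt (d\<^sup>2 + inverse (real (Suc n)))"
      using W0 unfolding d_def infdist_def
      by (auto simp: cINF_less_iff)
    moreover from this have "(dist x y)\<^sup>2 < (sqrt (d\<^sup>2 + inverse (real (Suc n))))\<^sup>2"
      by (intro power_strict_mono) auto
    ultimately show ?thesis by (auto simp: dist_norm real_sqrt_pow2 intro!: bexI[of _ y])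
  qed
  then obtain y where yW: "\<And>n. y n \<in> W"
    and yd: "\<And>n. (norm (x - y n))\<^sup>2 < d\<^sup>2 + inverse (real (Suc n))"
    by metis
  \<comment> \<open>By the parallelogram law, a minimising sequence is Cauchy.\<close>
  have par: "(norm (y m - y n))\<^sup>2 \<le> 2 * inverse (real (Suc m)) + 2 * inverse (real (Suc n))" for m n
  proof -
    define z where "z = (1/2) *\<^sub>R (y m + y n)"
    have "z \<in> W" unfolding z_def using sub yW by (simp add: subspace_add subspace_scale)
    have eq: "(norm (y m - y n))\<^sup>2 = 2 * (norm (x - y m))\<^sup>2 + 2 * (norm (x - y n))\<^sup>2 - 4 * (norm (x - z))\<^sup>2"
      unfolding z_def power2_norm_eq_inner
      by (simp add: inner_diff_left inner_diff_right inner_add_left inner_add_right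
          inner_commute algebra_simps)
    show ?thesis using eq dle[OF \<open>z \<in> W\<close>] yd[of m] yd[of n] by linarith
  qed
  have "Cauchy y"
  proof (rule metric_CauchyI)
    fix e :: real assume "e > 0"
    obtain N where N: "inverse (real (Suc N)) < e\<^sup>2 / 4"
      using reals_Archimedean[of "e\<^sup>2/4"] \<open>e > 0\<close> by auto
    have "dist (y m) (y n) < e" if "m \<ge> N" "n \<ge> N" for m n
    proof -
      have "inverse (real (Suc m)) \<le> inverse (real (Suc N))" "inverse (real (Suc n)) \<le> inverse (real (Suc N))"
        using that by (auto intro!: le_imp_inverse_le)
      then have "(norm (y m - y n))\<^sup>2 < e\<^sup>2" using par[of m n] N by linarith
      then show ?thesis using \<open>e > 0\<close> by (simp add: dist_norm power_less_imp_less_base)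
    qed
    then show "\<exists>M. \<forall>m\<ge>M. \<forall>n\<ge>M. dist (y m) (y n) < e" by blast
  qed
  then obtain p where p: "p \<in> W" "y \<longlonglongrightarrow> p"
    using com yW unfolding complete_def by blast
  have "(norm (x - p))\<^sup>2 \<le> d\<^sup>2 + 0"
  proof (rule LIMSEQ_le)
    show "(\<lambda>n. (norm (x - y n))\<^sup>2) \<longlonglongrightarrow> (norm (x - p))\<^sup>2"
      by (intro tendsto_intros p)
    show "(\<lambda>n. d\<^sup>2 + inverse (real (Suc n))) \<longlonglongrightarrow> d\<^sup>2 + 0"
      by (intro tendsto_intros LIMSEQ_inverse_real_of_nat)
    show "\<exists>N. \<forall>n\<ge>N. (norm (x - y n))\<^sup>2 \<le> d\<^sup>2 + inverse (real (Suc n))"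
      using yd less_imp_le by blast
  qed
  then have min: "(norm (x - p))\<^sup>2 \<le> (norm (x - z))\<^sup>2" if "z \<in> W" for z
    using dle[OF that] by linarith
  have "(x - p) \<bullet> k = 0" if "k \<in> W" for k
  proof (cases "k = 0")
    case False
    define t where "t = ((x - p) \<bullet> k) / (k \<bullet> k)"
    have kk: "k \<bullet> k > 0" using False by simp
    have "p + t *\<^sub>R k \<in> W" using sub p that by (simp add: subspace_add subspace_scale)
    from min[OF this] have "0 \<le> t * t * (k \<bullet> k) - 2 * t * ((x - p) \<bullet> k)"
      unfolding power2_norm_eq_inner
      by (simp add: inner_diff_left inner_diff_right inner_add_left inner_add_right
          inner_commute algebra_simps)
    also have "\<dots> = - (((x - p) \<bullet> k)\<^sup>2 / (k \<bullet> k))"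
      using kk by (simp add: t_def field_simps power2_eq_square)
    finally have "((x - p) \<bullet> k)\<^sup>2 / (k \<bullet> k) \<le> 0" by linarith
    then show ?thesis using kk by (simp add: divide_le_0_iff)
  qed auto
  then show ?thesis using p by blast
qed

text \<open>
  Zarantonello's theorem, in variational form on a closed subspace. With \<open>P\<close> the orthogonal
  projection onto \<open>W\<close>, the equation says \<open>P (A p) = 0\<close>, that is, \<open>p\<close> is fixed by
  \<open>p \<mapsto> p - t P (A p)\<close>. Expanding the square of the norm of a difference of two values shows
  that this map contracts by \<open>sqrt (1 - 2 t m + t\<^sup>2 L\<^sup>2)\<close>, and \<open>t = m / L\<^sup>2\<close> minimises this
  factor.
\<close>

lemma monotone_equation_solvable:
  fixes A :: "'h::real_inner \<Rightarrow> 'h"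
  assumes sub: "subspace W" and com: "complete W" and m: "m > 0"
    and mono: "\<And>p q. p \<in> W \<Longrightarrow> q \<in> W \<Longrightarrow> m * (norm (p - q))\<^sup>2 \<le> (A p - A q) \<bullet> (p - q)"
    and lip: "\<And>p q. p \<in> W \<Longrightarrow> q \<in> W \<Longrightarrow> norm (A p - A q) \<le> L * norm (p - q)"
  shows "\<exists>p\<in>W. \<forall>k\<in>W. A p \<bullet> k = 0"
proof -
  obtain P where PW: "\<And>x. P x \<in> W" and P: "\<And>x k. k \<in> W \<Longrightarrow> (x - P x) \<bullet> k = 0"
    using orthogonal_projection_exists[OF sub com] by metis
  \<comment> \<open>A Lipschitz constant below \<open>m\<close> (possible if \<open>W\<close> is trivial) would make the contraction factor the
    square root of a negative number.\<close>
  define M where "M = max L m"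
  have M: "M > 0" "M \<ge> L" "M \<ge> m" using m by (auto simp: M_def)
  define t where "t = m / M\<^sup>2"
  define T where "T p = p - t *\<^sub>R P (A p)" for p
  have t: "t > 0" using m M by (simp add: t_def)
  define c where "c = sqrt (1 - m\<^sup>2 / M\<^sup>2)"
  have mM: "0 < m\<^sup>2 / M\<^sup>2" "m\<^sup>2 / M\<^sup>2 \<le> 1" using m M by (auto simp: divide_le_eq power_mono)
  have c: "0 \<le> c" "c < 1" "c\<^sup>2 = 1 - m\<^sup>2 / M\<^sup>2"
    using mM by (auto simp: c_def)
  have TW: "T p \<in> W" if "p \<in> W" for p
    using that PW sub by (simp add: T_def subspace_diff subspace_scale)
  have contr: "dist (T p) (T q) \<le> c * dist p q" if pq: "p \<in> W" "q \<in> W" for p q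
  proof -
    define d where "d = p - q"
    define r where "r = P (A p) - P (A q)"
    have dW: "d \<in> W" and rW: "r \<in> W" using sub pq PW by (auto simp: d_def r_def subspace_diff)
    have "(A p - A q - r) \<bullet> k = 0" if "k \<in> W" for k
      using P[OF that, of "A p"] P[OF that, of "A q"] by (simp add: r_def algebra_simps inner_diff_left)
    then have rd: "r \<bullet> d = (A p - A q) \<bullet> d" and rr: "r \<bullet> r = (A p - A q) \<bullet> r"
      using dW rW by (auto simp: inner_diff_left)
    have "(norm r)\<^sup>2 \<le> norm (A p - A q) * norm r"
      unfolding power2_norm_eq_inner rr by (rule norm_cauchy_schwarz)
    then have "norm r \<le> norm (A p - A q)"
      by (metis mult_right_le_imp_le norm_ge_zero order_le_less power2_eq_square zero_less_norm_iff norm_zero)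
    also have "\<dots> \<le> M * norm d"
      using lip[OF pq] M mult_right_mono[of L M "norm d"] by (auto simp: d_def)
    finally have nr: "(norm r)\<^sup>2 \<le> M\<^sup>2 * (norm d)\<^sup>2"
      by (metis norm_ge_zero power_mono power_mult_distrib)
    have "(norm (T p - T q))\<^sup>2 = (norm d)\<^sup>2 - 2 * t * (r \<bullet> d) + t\<^sup>2 * (norm r)\<^sup>2"
    proof -
      have eq: "T p - T q = d - t *\<^sub>R r" by (simp add: T_def d_def r_def algebra_simps)
      show ?thesis unfolding eq power2_norm_eq_inner
        by (simp add: inner_diff_left inner_diff_right inner_commute algebra_simps power2_eq_square)
    qed
    also have "\<dots> \<le> (norm d)\<^sup>2 - 2 * t * (m * (norm d)\<^sup>2) + t\<^sup>2 * (M\<^sup>2 * (norm d)\<^sup>2)"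
      using mono[OF pq] rd nr t
      by (intro add_mono diff_mono mult_left_mono) (auto simp: d_def)
    also have "\<dots> = (c * norm d)\<^sup>2"
      using M unfolding power_mult_distrib c by (simp add: t_def field_simps power2_eq_square)
    finally show ?thesis
      using c by (auto simp: dist_norm d_def intro: power2_le_imp_le)
  qed
  have "\<exists>!p\<in>W. T p = p"
    by (rule Banach_fix[OF com _ c(1,2)]) (use TW contr subspace_0[OF sub] in auto)
  then obtain p where p: "p \<in> W" "T p = p" by blast
  then have "P (A p) = 0" using t by (simp add: T_def)
  then have "\<forall>k\<in>W. A p \<bullet> k = 0" using P[of _ "A p"] by auto
  then show ?thesis using p by blast
qed

lemma complete_orthogonal_comp:
  fixes Z :: "'h::{real_inner,complete_space} set"
  shows "complete (Z\<^sup>\<bottom>)"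
proof -
  have "Z\<^sup>\<bottom> = (\<Inter>y\<in>Z. {x. y \<bullet> x = 0})"
    by (auto simp: orthogonal_comp_def orthogonal_def)
  moreover have "closed {x. y \<bullet> x = 0}" for y :: 'h
    by (intro closed_Collect_eq continuous_intros)
  ultimately show ?thesis by (simp add: complete_eq_closed closed_INT)
qed

text \<open>
  Surjectivity is the previous lemma on the whole space, applied to \<open>G - y\<close>. The inverse of a
  strongly monotone Lipschitz map is again of this kind, which is what allows \<open>H\<close> to be
  expressed by \<open>h = g' (H)\<close> without losing strong monotonicity.
\<close>

lemma strongly_monotone_inverse:
  fixes G :: "'h::{real_inner,complete_space} \<Rightarrow> 'h"
  assumes m: "m > 0" and L: "L > 0"
    and mono: "\<And>y z. m * (norm (y - z))\<^sup>2 \<le> (G y - G z) \<bullet> (y - z)"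
    and lip: "\<And>y z. norm (G y - G z) \<le> L * norm (y - z)"
  obtains f where "\<And>y. G (f y) = y"
    and "\<And>y z. norm (f y - f z) \<le> (1 / m) * norm (y - z)"
    and "\<And>y z. (m / L\<^sup>2) * (norm (y - z))\<^sup>2 \<le> (f y - f z) \<bullet> (y - z)"
proof -
  have "\<exists>h. G h = y" for y
  proof -
    have "\<exists>p\<in>UNIV. \<forall>k\<in>UNIV. (G p - y) \<bullet> k = 0"
      by (rule monotone_equation_solvable[where m=m and L=L])
        (use m mono lip in \<open>auto simp: complete_UNIV\<close>)
    then obtain p where "(G p - y) \<bullet> (G p - y) = 0" by blast
    then show ?thesis by auto
  qed
  then obtain f where f: "\<And>y. G (f y) = y" by metis
  have lo: "m * (norm (f y - f z))\<^sup>2 \<le> (y - z) \<bullet> (f y - f z)" for y z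
    using mono[of "f y" "f z"] by (simp add: f)
  have 1: "norm (f y - f z) \<le> (1 / m) * norm (y - z)" for y z
  proof (cases "f y = f z")
    case False
    have "m * (norm (f y - f z))\<^sup>2 \<le> norm (y - z) * norm (f y - f z)"
      using lo[of y z] norm_cauchy_schwarz order_trans by blast
    then have "m * norm (f y - f z) \<le> norm (y - z)"
      using False by (simp add: power2_eq_square)
    then show ?thesis using m by (simp add: field_simps)
  qed (use m in simp)
  have 2: "(m / L\<^sup>2) * (norm (y - z))\<^sup>2 \<le> (f y - f z) \<bullet> (y - z)" for y z
  proof -
    have "(norm (y - z))\<^sup>2 \<le> (L * norm (f y - f z))\<^sup>2"
      using lip[of "f y" "f z"] by (intro power_mono) (auto simp: f)
    then have "(m / L\<^sup>2) * (norm (y - z))\<^sup>2 \<le> (m / L\<^sup>2) * (L * norm (f y - f z))\<^sup>2"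
      using m by (intro mult_left_mono) auto
    also have "\<dots> = m * (norm (f y - f z))\<^sup>2" using L by (simp add: power_mult_distrib)
    also have "\<dots> \<le> (f y - f z) \<bullet> (y - z)" using lo[of y z] by (simp add: inner_commute)
    finally show ?thesis .
  qed
  show ?thesis using that f 1 2 by blast
qed


section \<open>The Hilbert space of square-integrable functions\<close>

declare lebesgue_on_UNIV_eq [simp]

lemma L2_D:
  assumes "f \<in> L2 \<Omega>"
  shows "f \<in> borel_measurable (lebesgue_on \<Omega>)" "integrable (lebesgue_on \<Omega>) (\<lambda>x. (norm (f x))\<^sup>2)"
  using assms by (auto simp: L2_def)

lemma L2_I:
  assumes "f \<in> borel_measurable (lebesgue_on \<Omega>)" "integrable (lebesgue_on \<Omega>) (\<lambda>x. (norm (f x))\<^sup>2)"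
  shows "f \<in> L2 \<Omega>"
  using assms by (auto simp: L2_def)

lemma L2_bound:
  assumes f: "f \<in> borel_measurable (lebesgue_on \<Omega>)" and g: "g \<in> L2 \<Omega>"
    and le: "AE x in lebesgue_on \<Omega>. norm (f x) \<le> c * norm (g x)"
  shows "f \<in> L2 \<Omega>"
proof (rule L2_I[OF f])
  note [measurable] = f L2_D(1)[OF g]
  have int: "integrable (lebesgue_on \<Omega>) (\<lambda>x. c\<^sup>2 * (norm (g x))\<^sup>2)" using L2_D(2)[OF g] by simp
  show "integrable (lebesgue_on \<Omega>) (\<lambda>x. (norm (f x))\<^sup>2)"
    by (rule Bochner_Integration.integrable_bound[OF int])
      (use le in \<open>auto simp flip: power_mult_distrib intro: power_mono elim!: eventually_mono\<close>)
qed

lemma L2_scaleR: "f \<in> L2 \<Omega> \<Longrightarrow> (\<lambda>x. c *\<^sub>R f x) \<in> L2 \<Omega>"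
  by (rule L2_bound[where g=f and c="\<bar>c\<bar>"]) (auto dest: L2_D)

lemma L2_uminus: "f \<in> L2 \<Omega> \<Longrightarrow> (\<lambda>x. - f x) \<in> L2 \<Omega>"
  using L2_scaleR[of f \<Omega> "-1"] by simp

lemma norm_add_power2_le: "(norm (x + y))\<^sup>2 \<le> 2 * (norm x)\<^sup>2 + 2 * (norm (y::'a::real_normed_vector))\<^sup>2"
proof -
  have "(norm (x + y))\<^sup>2 \<le> (norm x + norm y)\<^sup>2" by (simp add: norm_triangle_ineq power_mono)
  also have "\<dots> \<le> 2 * (norm x)\<^sup>2 + 2 * (norm y)\<^sup>2"
    using zero_le_power2[of "norm x - norm y"] by (simp add: power2_eq_square algebra_simps)
  finally show ?thesis .
qed

lemma L2_add:
  assumes "f \<in> L2 \<Omega>" "g \<in> L2 \<Omega>"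
  shows "(\<lambda>x. f x + g x) \<in> L2 \<Omega>"
proof (rule L2_I)
  note [measurable] = assms[THEN L2_D(1)]
  show "(\<lambda>x. f x + g x) \<in> borel_measurable (lebesgue_on \<Omega>)" by measurable
  have int: "integrable (lebesgue_on \<Omega>) (\<lambda>x. 2 * (norm (f x))\<^sup>2 + 2 * (norm (g x))\<^sup>2)"
    using assms[THEN L2_D(2)] by auto
  show "integrable (lebesgue_on \<Omega>) (\<lambda>x. (norm (f x + g x))\<^sup>2)"
    by (rule Bochner_Integration.integrable_bound[OF int]) (auto intro: norm_add_power2_le)
qed

lemma L2_diff: "f \<in> L2 \<Omega> \<Longrightarrow> g \<in> L2 \<Omega> \<Longrightarrow> (\<lambda>x. f x - g x) \<in> L2 \<Omega>"
  using L2_add[OF _ L2_uminus, of f \<Omega> g] by simp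

lemma L2_inner_integrable:
  assumes "f \<in> L2 \<Omega>" "g \<in> L2 \<Omega>"
  shows "integrable (lebesgue_on \<Omega>) (\<lambda>x. f x \<bullet> g x)"
proof -
  note [measurable] = assms[THEN L2_D(1)]
  have int: "integrable (lebesgue_on \<Omega>) (\<lambda>x. (norm (f x))\<^sup>2 + (norm (g x))\<^sup>2)"
    using assms[THEN L2_D(2)] by auto
  have "\<bar>f x \<bullet> g x\<bar> \<le> (norm (f x))\<^sup>2 + (norm (g x))\<^sup>2" for x
  proof -
    have "\<bar>f x \<bullet> g x\<bar> \<le> norm (f x) * norm (g x)" by (rule Cauchy_Schwarz_ineq2)
    also have "\<dots> \<le> (norm (f x))\<^sup>2 + (norm (g x))\<^sup>2"
      using zero_le_power2[of "norm (f x) - norm (g x)"] sum_power2_ge_zero[of "norm (f x)" "norm (g x)"]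
      by (simp add: power2_eq_square algebra_simps) (smt (verit) mult_nonneg_nonneg norm_ge_zero)
    finally show ?thesis .
  qed
  then show ?thesis
    by (intro Bochner_Integration.integrable_bound[OF int]) auto
qed

lemma L2_inner_cong_AE:
  assumes "f \<in> L2 \<Omega>" "f' \<in> L2 \<Omega>" "g \<in> L2 \<Omega>" "g' \<in> L2 \<Omega>"
    "AE x in lebesgue_on \<Omega>. f x = f' x" "AE x in lebesgue_on \<Omega>. g x = g' x"
  shows "L2_inner \<Omega> f g = L2_inner \<Omega> f' g'"
proof -
  note [measurable] = assms(1-4)[THEN L2_D(1)]
  show ?thesis
    unfolding L2_inner_def
  proof (rule integral_cong_AE)
    show "AE x in lebesgue_on \<Omega>. f x \<bullet> g x = f' x \<bullet> g' x"
      using assms(5,6) by eventually_elim simp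
  qed measurable
qed

text \<open>
  The fixed-point argument needs a genuine complete inner product space, so square-integrable
  functions on the whole plane are identified when equal almost everywhere. Since a type
  cannot depend on \<open>\<Omega>\<close>, functions on \<open>\<Omega>\<close> enter it through their extension by zero.
\<close>

definition ae_equal_L2 :: "(real^2 \<Rightarrow> 'b::euclidean_space) \<Rightarrow> (real^2 \<Rightarrow> 'b) \<Rightarrow> bool" where
  "ae_equal_L2 f g \<longleftrightarrow> f \<in> L2 UNIV \<and> g \<in> L2 UNIV \<and> (AE x in lebesgue. f x = g x)"

lemma zero_in_L2: "(\<lambda>x. 0) \<in> L2 \<Omega>"
  by (rule L2_I) auto

quotient_type (overloaded) 'b l2 = "real^2 \<Rightarrow> 'b::euclidean_space" / partial: ae_equal_L2
  morphisms rep_l2 cls_l2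
proof (rule part_equivpI)
  show "\<exists>x. ae_equal_L2 x x" by (auto simp: ae_equal_L2_def intro!: exI[of _ "\<lambda>x. 0"] zero_in_L2)
  show "symp ae_equal_L2" by (auto simp: symp_def ae_equal_L2_def eq_commute)
  show "transp ae_equal_L2" by (rule transpI) (auto simp: ae_equal_L2_def elim!: eventually_elim2)
qed

instantiation l2 :: (euclidean_space) real_inner
begin

lift_definition zero_l2 :: "'a l2" is "\<lambda>x. 0"
  by (auto simp: ae_equal_L2_def zero_in_L2)

lift_definition plus_l2 :: "'a l2 \<Rightarrow> 'a l2 \<Rightarrow> 'a l2" is "\<lambda>f g x. f x + g x"
  by (auto simp: ae_equal_L2_def L2_add)

lift_definition minus_l2 :: "'a l2 \<Rightarrow> 'a l2 \<Rightarrow> 'a l2" is "\<lambda>f g x. f x - g x"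
  by (auto simp: ae_equal_L2_def L2_diff)

lift_definition uminus_l2 :: "'a l2 \<Rightarrow> 'a l2" is "\<lambda>f x. - f x"
  by (auto simp: ae_equal_L2_def L2_uminus)

lift_definition scaleR_l2 :: "real \<Rightarrow> 'a l2 \<Rightarrow> 'a l2" is "\<lambda>c f x. c *\<^sub>R f x"
  by (auto simp: ae_equal_L2_def L2_scaleR)

lift_definition inner_l2 :: "'a l2 \<Rightarrow> 'a l2 \<Rightarrow> real" is "L2_inner UNIV"
  unfolding ae_equal_L2_def by (rule L2_inner_cong_AE) (simp_all only: lebesgue_on_UNIV_eq)

definition norm_l2 :: "'a l2 \<Rightarrow> real" where "norm_l2 u = sqrt (u \<bullet> u)"
definition sgn_l2 :: "'a l2 \<Rightarrow> 'a l2" where "sgn_l2 u = inverse (norm u) *\<^sub>R u"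
definition dist_l2 :: "'a l2 \<Rightarrow> 'a l2 \<Rightarrow> real" where "dist_l2 u v = norm (u - v)"
definition uniformity_l2 :: "('a l2 \<times> 'a l2) filter" where
  "uniformity_l2 = (INF e\<in>{0<..}. principal {(x, y). dist (x::'a l2) y < e})"
definition open_l2 :: "'a l2 set \<Rightarrow> bool" where
  "open_l2 U \<longleftrightarrow> (\<forall>x\<in>U. \<forall>\<^sub>F (x', y) in uniformity. x' = x \<longrightarrow> y \<in> U)"

instance
proof
  fix u v w :: "'a l2" and c d :: real
  show "u + v + w = u + (v + w)" by transfer (auto simp: ae_equal_L2_def L2_add add.assoc)
  show "u + v = v + u" by transfer (auto simp: ae_equal_L2_def L2_add add.commute)
  show "0 + u = u" by transfer (auto simp: ae_equal_L2_def)
  show "- u + u = 0" by transfer (auto simp: ae_equal_L2_def zero_in_L2)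
  show "u - v = u + - v" by transfer (auto simp: ae_equal_L2_def L2_diff)
  show "c *\<^sub>R (u + v) = c *\<^sub>R u + c *\<^sub>R v"
    by transfer (auto simp: ae_equal_L2_def scaleR_add_right intro!: L2_add L2_scaleR)
  show "(c + d) *\<^sub>R u = c *\<^sub>R u + d *\<^sub>R u"
    by transfer (auto simp: ae_equal_L2_def scaleR_add_left intro!: L2_add L2_scaleR)
  show "c *\<^sub>R d *\<^sub>R u = (c * d) *\<^sub>R u"
    by transfer (auto simp: ae_equal_L2_def  intro!: L2_add L2_scaleR)
  show "1 *\<^sub>R u = u" by transfer (auto simp: ae_equal_L2_def)
  show "dist u v = norm (u - v)" by (rule dist_l2_def)
  show "sgn u = inverse (norm u) *\<^sub>R u" by (rule sgn_l2_def)
  show "uniformity = (INF e\<in>{0<..}. principal {(x, y). dist (x::'a l2) y < e})" by (rule uniformity_l2_def)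
  show "open U \<longleftrightarrow> (\<forall>x\<in>U. \<forall>\<^sub>F (x', y) in uniformity. x' = x \<longrightarrow> y \<in> U)" for U :: "'a l2 set"
    by (rule open_l2_def)
  show "u \<bullet> v = v \<bullet> u" by transfer (simp add: L2_inner_def inner_commute)
  show "(u + v) \<bullet> w = u \<bullet> w + v \<bullet> w"
  proof transfer
    fix f g h :: "real^2 \<Rightarrow> 'a"
    assume "ae_equal_L2 f f" "ae_equal_L2 g g" "ae_equal_L2 h h"
    then have "f \<in> L2 UNIV" "g \<in> L2 UNIV" "h \<in> L2 UNIV" by (auto simp: ae_equal_L2_def)
    then show "L2_inner UNIV (\<lambda>x. f x + g x) h = L2_inner UNIV f h + L2_inner UNIV g h"
      using L2_inner_integrable[of f UNIV h] L2_inner_integrable[of g UNIV h]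
      by (simp add: L2_inner_def inner_add_left Bochner_Integration.integral_add)
  qed
  show "(c *\<^sub>R u) \<bullet> v = c * (u \<bullet> v)" by transfer (simp add: L2_inner_def)
  show "0 \<le> u \<bullet> u" by transfer (simp add: L2_inner_def)
  show "norm u = sqrt (u \<bullet> u)" by (rule norm_l2_def)
  show "u \<bullet> u = 0 \<longleftrightarrow> u = 0"
  proof (transfer)
    fix f :: "real^2 \<Rightarrow> 'a" assume "ae_equal_L2 f f"
    then have f: "f \<in> L2 UNIV" by (simp add: ae_equal_L2_def)
    have "L2_inner UNIV f f = 0 \<longleftrightarrow> (AE x in lebesgue. f x \<bullet> f x = 0)"
      unfolding L2_inner_def using L2_inner_integrable[OF f f]
      by (simp add: integral_nonneg_eq_0_iff_AE)
    then show "L2_inner UNIV f f = 0 \<longleftrightarrow> ae_equal_L2 f (\<lambda>x. 0)"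
      using f by (simp add: ae_equal_L2_def zero_in_L2)
  qed
qed

end

lemma rep_l2_in_L2: "rep_l2 u \<in> L2 UNIV"
  by (metis Quotient_l2 Quotient_rep_reflp ae_equal_L2_def)

lemma cls_rep_l2 [simp]: "cls_l2 (rep_l2 u) = u"
  by (metis Quotient_l2 Quotient_abs_rep)

lemma cls_l2_eq_iff:
  assumes "f \<in> L2 UNIV" "g \<in> L2 UNIV"
  shows "cls_l2 f = cls_l2 g \<longleftrightarrow> (AE x in lebesgue. f x = g x)"
  using Quotient_rel[OF Quotient_l2, of f g] assms by (auto simp: ae_equal_L2_def)

lemma cls_l2_add: "f \<in> L2 UNIV \<Longrightarrow> g \<in> L2 UNIV \<Longrightarrow> cls_l2 (\<lambda>x. f x + g x) = cls_l2 f + cls_l2 g"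
  by (rule plus_l2.abs_eq[symmetric]) (auto simp: ae_equal_L2_def)

lemma cls_l2_diff: "f \<in> L2 UNIV \<Longrightarrow> g \<in> L2 UNIV \<Longrightarrow> cls_l2 (\<lambda>x. f x - g x) = cls_l2 f - cls_l2 g"
  by (rule minus_l2.abs_eq[symmetric]) (auto simp: ae_equal_L2_def)

lemma inner_cls_l2: "f \<in> L2 UNIV \<Longrightarrow> g \<in> L2 UNIV \<Longrightarrow> cls_l2 f \<bullet> cls_l2 g = L2_inner UNIV f g"
  by (rule inner_l2.abs_eq) (auto simp: ae_equal_L2_def)

lemma nn_integral_norm_cls_l2:
  assumes "f \<in> L2 UNIV"
  shows "(\<integral>\<^sup>+x. ennreal ((norm (f x))\<^sup>2) \<partial>lebesgue) = ennreal ((norm (cls_l2 f))\<^sup>2)"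
proof -
  have "(norm (cls_l2 f))\<^sup>2 = (LINT x|lebesgue. (norm (f x))\<^sup>2)"
    unfolding power2_norm_eq_inner by (simp add: inner_cls_l2[OF assms assms] L2_inner_def)
  then show ?thesis using L2_D(2)[OF assms] by (simp add: nn_integral_eq_integral)
qed

text \<open>
  Riesz--Fischer. Along a subsequence whose increments have norm below \<open>(1/4)^k\<close>, the sum of
  \<open>2^k\<close> times the squared increments is integrable, hence finite almost everywhere, so the
  subsequence converges pointwise almost everywhere. Fatou's lemma bounds the distance to the
  pointwise limit.
\<close>

instance l2 :: (euclidean_space) complete_space
proof
  fix X :: "nat \<Rightarrow> 'a l2" assume X: "Cauchy X"
  have "\<exists>N. \<forall>m\<ge>N. \<forall>n\<ge>N. dist (X m) (X n) < (1/4)^k" for k :: nat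
    using X by (rule metric_CauchyD) simp
  then obtain N where N: "\<And>k m n. m \<ge> N k \<Longrightarrow> n \<ge> N k \<Longrightarrow> dist (X m) (X n) < (1/4)^k"
    by metis
  define r where "r k = k + (\<Sum>i\<le>k. N i)" for k
  have r: "strict_mono r" unfolding strict_mono_Suc_iff by (simp add: r_def)
  have rN: "r n \<ge> N k" if "n \<ge> k" for n k
  proof -
    have "N k \<le> (\<Sum>i\<le>n. N i)" using that by (intro member_le_sum) auto
    then show ?thesis by (simp add: r_def)
  qed
  define f where "f k = rep_l2 (X (r k))" for k
  have fL: "f k \<in> L2 UNIV" for k by (simp add: f_def rep_l2_in_L2)
  have fc: "cls_l2 (f k) = X (r k)" for k by (simp add: f_def)
  have fm [measurable]: "f k \<in> borel_measurable lebesgue" for k using L2_D(1)[OF fL[of k]] by simp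
  have tail: "(\<integral>\<^sup>+x. ennreal ((norm (f k x - f n x))\<^sup>2) \<partial>lebesgue) \<le> ennreal ((1/16)^n)" if "k \<ge> n" for k n
  proof -
    have "norm (X (r k) - X (r n)) \<le> (1/4)^n"
      using N[OF rN[OF that] rN[OF order_refl]] by (simp add: dist_norm)
    then have "(norm (X (r k) - X (r n)))\<^sup>2 \<le> ((1/4)^n)\<^sup>2" by (intro power_mono) auto
    also have "\<dots> = (1/16)^n" by (simp add: power_even_eq power_mult[symmetric] mult.commute power2_eq_square flip: power_mult_distrib)
    finally show ?thesis
      using nn_integral_norm_cls_l2[OF L2_diff[OF fL fL], of k n]
      by (simp add: cls_l2_diff fL fc ennreal_leI)
  qed
  define d where "d k x = f (Suc k) x - f k x" for k x
  have dm [measurable]: "d k \<in> borel_measurable lebesgue" for k unfolding d_def by measurable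
  have "(\<integral>\<^sup>+x. (\<Sum>k. ennreal (2^k * (norm (d k x))\<^sup>2)) \<partial>lebesgue)
      = (\<Sum>k. \<integral>\<^sup>+x. ennreal (2^k * (norm (d k x))\<^sup>2) \<partial>lebesgue)"
    by (rule nn_integral_suminf) measurable
  also have "\<dots> \<le> (\<Sum>k. ennreal ((1/8)^k))"
  proof (rule suminf_le)
    fix k
    have "(\<integral>\<^sup>+x. ennreal (2^k * (norm (d k x))\<^sup>2) \<partial>lebesgue) = ennreal (2^k) * (\<integral>\<^sup>+x. ennreal ((norm (d k x))\<^sup>2) \<partial>lebesgue)"
      by (simp add: ennreal_mult nn_integral_cmult)
    also have "\<dots> \<le> ennreal (2^k) * ennreal ((1/16)^k)"
      using tail[of k "Suc k"] by (intro mult_left_mono) (auto simp: d_def)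
    also have "\<dots> = ennreal ((1/8)^k)"
      by (simp add: ennreal_mult[symmetric] flip: power_mult_distrib)
    finally show "(\<integral>\<^sup>+x. ennreal (2^k * (norm (d k x))\<^sup>2) \<partial>lebesgue) \<le> ennreal ((1/8)^k)" .
  qed auto
  also have "\<dots> < \<infinity>"
    by (subst suminf_ennreal2) (auto intro!: summable_geometric)
  finally have "(\<integral>\<^sup>+x. (\<Sum>k. ennreal (2^k * (norm (d k x))\<^sup>2)) \<partial>lebesgue) \<noteq> \<infinity>" by simp
  then have "AE x in lebesgue. (\<Sum>k. ennreal (2^k * (norm (d k x))\<^sup>2)) \<noteq> \<infinity>"
    by (intro nn_integral_PInf_AE) auto
  then have conv: "AE x in lebesgue. convergent (\<lambda>k. f k x)"
  proof (eventually_elim)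
    fix x assume "(\<Sum>k. ennreal (2^k * (norm (d k x))\<^sup>2)) \<noteq> \<infinity>"
    then have s: "summable (\<lambda>k. 2^k * (norm (d k x))\<^sup>2)"
      by (intro summable_suminf_not_top) auto
    have "summable (\<lambda>k. (1/2)^k + 2^k * (norm (d k x))\<^sup>2)"
      by (intro summable_add s summable_geometric) simp
    \<comment> \<open>Weighted AM-GM turns summability of the squares into that of the norms.\<close>
    moreover have "norm (d k x) \<le> (1/2)^k + 2^k * (norm (d k x))\<^sup>2" for k
    proof -
      have "0 \<le> 2^k * (norm (d k x) - (1/2)^k)\<^sup>2" by simp
      also have "\<dots> = 2^k * (norm (d k x))\<^sup>2 - 2 * (2^k * (1/2)^k) * norm (d k x) + 2^k * (1/2)^k * (1/2)^k"
        by (simp add: power2_eq_square algebra_simps)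
      also have "\<dots> = 2^k * (norm (d k x))\<^sup>2 - 2 * norm (d k x) + (1/2)^k"
        by (simp flip: power_mult_distrib)
      finally show ?thesis using norm_ge_zero[of "d k x"] by linarith
    qed
    ultimately have "summable (\<lambda>k. d k x)"
      by (intro summable_comparison_test[of "\<lambda>k. d k x"]) auto
    then have "convergent (\<lambda>n. \<Sum>k<n. d k x)" by (simp add: summable_iff_convergent)
    then have "convergent (\<lambda>n. f n x - f 0 x)"
      unfolding d_def sum_lessThan_telescope[of "\<lambda>k. f k x"] .
    from convergent_add[OF this convergent_const[of "f 0 x"]] show "convergent (\<lambda>k. f k x)" by simp
  qed
  define F where "F x = lim (\<lambda>k. f k x)" for x
  have Fm [measurable]: "F \<in> borel_measurable lebesgue"
    unfolding F_def by (rule borel_measurable_lim_metric) measurable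
  have near: "(\<integral>\<^sup>+x. ennreal ((norm (F x - f n x))\<^sup>2) \<partial>lebesgue) \<le> ennreal ((1/16)^n)" for n
  proof -
    have "(\<integral>\<^sup>+x. ennreal ((norm (F x - f n x))\<^sup>2) \<partial>lebesgue)
        = (\<integral>\<^sup>+x. liminf (\<lambda>k. ennreal ((norm (f k x - f n x))\<^sup>2)) \<partial>lebesgue)"
      using conv
    proof (intro nn_integral_cong_AE, eventually_elim)
      fix x assume "convergent (\<lambda>k. f k x)"
      then have "(\<lambda>k. f k x) \<longlonglongrightarrow> F x" by (simp add: F_def convergent_LIMSEQ_iff)
      then have "(\<lambda>k. ennreal ((norm (f k x - f n x))\<^sup>2)) \<longlonglongrightarrow> ennreal ((norm (F x - f n x))\<^sup>2)"
        by (intro tendsto_intros tendsto_ennrealI)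
      then show "ennreal ((norm (F x - f n x))\<^sup>2) = liminf (\<lambda>k. ennreal ((norm (f k x - f n x))\<^sup>2))"
        by (rule lim_imp_Liminf[OF sequentially_bot, symmetric])
    qed
    also have "\<dots> \<le> liminf (\<lambda>k. \<integral>\<^sup>+x. ennreal ((norm (f k x - f n x))\<^sup>2) \<partial>lebesgue)"
      by (rule nn_integral_liminf) measurable
    also have "\<dots> \<le> limsup (\<lambda>k. \<integral>\<^sup>+x. ennreal ((norm (f k x - f n x))\<^sup>2) \<partial>lebesgue)"
      by (rule Liminf_le_Limsup) simp
    also have "\<dots> \<le> ennreal ((1/16)^n)"
      by (rule Limsup_bounded) (use tail in \<open>auto simp: eventually_sequentially\<close>)
    finally show ?thesis .
  qed
  have FfL: "(\<lambda>x. F x - f n x) \<in> L2 UNIV" for n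
  proof (rule L2_I)
    have "(\<integral>\<^sup>+x. ennreal ((norm (F x - f n x))\<^sup>2) \<partial>lebesgue) < \<infinity>"
      using near[of n] by (simp add: le_less_trans)
    then show "integrable (lebesgue_on UNIV) (\<lambda>x. (norm (F x - f n x))\<^sup>2)"
      by (intro integrableI_bounded) auto
  qed simp
  have FL: "F \<in> L2 UNIV" using L2_add[OF FfL[of 0] fL[of 0]] by simp
  have dist: "norm (X (r n) - cls_l2 F) \<le> (1/4)^n" for n
  proof -
    have "ennreal ((norm (cls_l2 F - X (r n)))\<^sup>2) \<le> ennreal ((1/16)^n)"
      using near[of n] nn_integral_norm_cls_l2[OF FfL[of n]] by (simp add: cls_l2_diff FL fL fc)
    then have "(norm (cls_l2 F - X (r n)))\<^sup>2 \<le> (1/16)^n" by (simp add: ennreal_le_iff)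
    also have "(1/16)^n = (((1/4)::real)^n)\<^sup>2" by (simp add: power_even_eq power_mult[symmetric] mult.commute power2_eq_square flip: power_mult_distrib)
    finally show ?thesis
      by (subst norm_minus_commute) (rule power2_le_imp_le, auto)
  qed
  have "(\<lambda>n. (1/4)^n :: real) \<longlonglongrightarrow> 0" by (rule LIMSEQ_realpow_zero) auto
  then have "(\<lambda>n. X (r n) - cls_l2 F) \<longlonglongrightarrow> 0"
    by (rule Lim_null_comparison[rotated]) (use dist in auto)
  then have "(X \<circ> r) \<longlonglongrightarrow> cls_l2 F" by (subst LIM_zero_iff[symmetric]) (simp add: o_def)
  then show "convergent X" using Cauchy_converges_subseq[OF X r] by (auto simp: convergent_def)
qed

text \<open>
  Extension by zero embeds \<open>L2 \<Omega>\<close> isometrically; through it Cauchy--Schwarz, the triangle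
  inequality and definiteness come for \<open>L2_norm \<Omega>\<close> from the type class of inner product spaces.
\<close>

definition ext_l2 :: "(real^2) set \<Rightarrow> (real^2 \<Rightarrow> 'b::euclidean_space) \<Rightarrow> 'b l2" where
  "ext_l2 \<Omega> f = cls_l2 (\<lambda>x. indicator \<Omega> x *\<^sub>R f x)"

context
  fixes \<Omega> :: "(real^2) set"
  assumes \<Omega>: "\<Omega> \<in> sets lebesgue"
begin

lemma ext_in_L2_iff: "(\<lambda>x. indicator \<Omega> x *\<^sub>R f x) \<in> L2 UNIV \<longleftrightarrow> f \<in> L2 \<Omega>"
proof -
  have "(norm (indicator \<Omega> x *\<^sub>R f x))\<^sup>2 = indicator \<Omega> x *\<^sub>R (norm (f x))\<^sup>2" for x
    by (simp add: indicator_def)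
  then show ?thesis using \<Omega>
    by (simp add: L2_def borel_measurable_restrict_space_iff integrable_restrict_space)
qed

lemma ext_l2_eq_iff:
  assumes "f \<in> L2 \<Omega>" "g \<in> L2 \<Omega>"
  shows "ext_l2 \<Omega> f = ext_l2 \<Omega> g \<longleftrightarrow> (AE x in lebesgue_on \<Omega>. f x = g x)"
proof -
  have "ext_l2 \<Omega> f = ext_l2 \<Omega> g \<longleftrightarrow> (AE x in lebesgue. indicator \<Omega> x *\<^sub>R f x = indicator \<Omega> x *\<^sub>R g x)"
    unfolding ext_l2_def by (rule cls_l2_eq_iff) (simp_all only: ext_in_L2_iff assms)
  also have "\<dots> \<longleftrightarrow> (AE x in lebesgue. x \<in> \<Omega> \<longrightarrow> f x = g x)"
    by (intro arg_cong2[where f=eventually] ext) (auto simp: indicator_def)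
  also have "\<dots> \<longleftrightarrow> (AE x in lebesgue_on \<Omega>. f x = g x)"
    using \<Omega> by (simp add: AE_restrict_space_iff)
  finally show ?thesis .
qed

lemma ext_l2_add: "f \<in> L2 \<Omega> \<Longrightarrow> g \<in> L2 \<Omega> \<Longrightarrow> ext_l2 \<Omega> (\<lambda>x. f x + g x) = ext_l2 \<Omega> f + ext_l2 \<Omega> g"
  unfolding ext_l2_def by (simp add: ext_in_L2_iff scaleR_add_right cls_l2_add)

lemma ext_l2_diff: "f \<in> L2 \<Omega> \<Longrightarrow> g \<in> L2 \<Omega> \<Longrightarrow> ext_l2 \<Omega> (\<lambda>x. f x - g x) = ext_l2 \<Omega> f - ext_l2 \<Omega> g"
  unfolding ext_l2_def by (simp add: ext_in_L2_iff scaleR_diff_right cls_l2_diff)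

lemma inner_ext_l2:
  assumes "f \<in> L2 \<Omega>" "g \<in> L2 \<Omega>"
  shows "ext_l2 \<Omega> f \<bullet> ext_l2 \<Omega> g = L2_inner \<Omega> f g"
proof -
  have "ext_l2 \<Omega> f \<bullet> ext_l2 \<Omega> g = L2_inner UNIV (\<lambda>x. indicator \<Omega> x *\<^sub>R f x) (\<lambda>x. indicator \<Omega> x *\<^sub>R g x)"
    unfolding ext_l2_def by (rule inner_cls_l2) (simp_all only: ext_in_L2_iff assms)
  also have "\<dots> = (LINT x|lebesgue. indicator \<Omega> x *\<^sub>R (f x \<bullet> g x))"
    unfolding L2_inner_def lebesgue_on_UNIV_eq
    by (intro Bochner_Integration.integral_cong refl) (simp add: indicator_def)
  also have "\<dots> = L2_inner \<Omega> f g"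
    using \<Omega> by (simp add: L2_inner_def integral_restrict_space)
  finally show ?thesis .
qed

lemma norm_ext_l2: "f \<in> L2 \<Omega> \<Longrightarrow> norm (ext_l2 \<Omega> f) = L2_norm \<Omega> f"
  by (simp add: norm_eq_sqrt_inner inner_ext_l2 L2_norm_def)

end


section \<open>Smooth bump functions and the fundamental lemma\<close>

lemma L2_bounded_on_finite:
  assumes "\<Omega> \<in> lmeasurable" and f: "f \<in> borel_measurable (lebesgue_on \<Omega>)" and b: "\<And>x. x \<in> \<Omega> \<Longrightarrow> norm (f x) \<le> c"
  shows "f \<in> L2 \<Omega>"
proof (rule L2_bound[OF f])
  show "(\<lambda>x. c) \<in> L2 \<Omega>"
  proof (rule L2_I)
    interpret finite_measure "lebesgue_on \<Omega>" by (rule finite_measure_lebesgue_on) fact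
    show "integrable (lebesgue_on \<Omega>) (\<lambda>x. (norm c)\<^sup>2)" by (rule integrable_const)
  qed simp
  show "AE x in lebesgue_on \<Omega>. norm (f x) \<le> 1 * norm c"
  proof (rule AE_I2)
    fix x assume "x \<in> space (lebesgue_on \<Omega>)"
    then show "norm (f x) \<le> 1 * norm c" using b[of x] by auto
  qed
qed

text \<open>
  Test functions on the plane are built as products of functions of one variable, for which
  smoothness is handled by a one-dimensional analogue of \<open>Ck\<close>.
\<close>

primrec real_Ck :: "nat \<Rightarrow> (real \<Rightarrow> real) \<Rightarrow> bool" where
  "real_Ck 0 f \<longleftrightarrow> continuous_on UNIV f"
| "real_Ck (Suc k) f \<longleftrightarrow> (\<exists>f'. (\<forall>t. (f has_real_derivative f' t) (at t)) \<and> real_Ck k f')"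

lemma real_Ck_Suc_imp: "real_Ck (Suc k) f \<Longrightarrow> real_Ck k f"
proof (induction k arbitrary: f)
  case 0
  then show ?case
    by (auto simp: continuous_on_eq_continuous_at intro: DERIV_isCont)
next
  case (Suc k)
  then show ?case by (subst real_Ck.simps) (metis real_Ck.simps(2))
qed

lemma real_Ck_add: "real_Ck k f \<Longrightarrow> real_Ck k g \<Longrightarrow> real_Ck k (\<lambda>t. f t + g t)"
proof (induction k arbitrary: f g)
  case 0
  then show ?case by (auto intro!: continuous_intros)
next
  case (Suc k)
  then obtain f' g' where "\<And>t. (f has_real_derivative f' t) (at t)" "real_Ck k f'"
    "\<And>t. (g has_real_derivative g' t) (at t)" "real_Ck k g'" by auto
  then show ?case
    unfolding real_Ck.simps by (intro exI[of _ "\<lambda>t. f' t + g' t"] conjI allI DERIV_add Suc.IH)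
qed

lemma real_Ck_mult: "real_Ck k f \<Longrightarrow> real_Ck k g \<Longrightarrow> real_Ck k (\<lambda>t. f t * g t)"
proof (induction k arbitrary: f g)
  case 0
  then show ?case by (auto intro!: continuous_intros)
next
  case (Suc k)
  then obtain f' g' where *: "\<And>t. (f has_real_derivative f' t) (at t)" "real_Ck k f'"
    "\<And>t. (g has_real_derivative g' t) (at t)" "real_Ck k g'" by auto
  have "real_Ck k (\<lambda>t. f' t * g t + f t * g' t)"
    by (intro real_Ck_add Suc.IH * real_Ck_Suc_imp[OF Suc.prems(1)] real_Ck_Suc_imp[OF Suc.prems(2)])
  moreover have "((\<lambda>t. f t * g t) has_real_derivative f' t * g t + f t * g' t) (at t)" for t
    using DERIV_mult'[OF *(1) *(3)] by (simp add: add.commute)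
  ultimately show ?case
    unfolding real_Ck.simps by (intro exI[of _ "\<lambda>t. f' t * g t + f t * g' t"] conjI allI)
qed

lemma real_Ck_affine: "real_Ck k f \<Longrightarrow> real_Ck k (\<lambda>t. f (a * t + b))"
proof (induction k arbitrary: f)
  case 0
  then show ?case by (auto intro!: continuous_intros intro: continuous_on_compose2[of UNIV f])
next
  case (Suc k)
  then obtain f' where *: "\<And>t. (f has_real_derivative f' t) (at t)" "real_Ck k f'" by auto
  have const: "real_Ck k (\<lambda>t. a)" for a by (induction k arbitrary: a) (auto intro!: exI[of _ "\<lambda>t. 0"])
  have "real_Ck k (\<lambda>t. f' (a * t + b) * a)" by (intro real_Ck_mult const Suc.IH *)
  moreover have "((\<lambda>t. f (a * t + b)) has_real_derivative f' (a * t + b) * a) (at t)" for t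
    by (rule DERIV_chain2[OF *(1)]) (auto intro!: derivative_eq_intros)
  ultimately show ?case
    unfolding real_Ck.simps by (intro exI[of _ "\<lambda>t. f' (a * t + b) * a"] conjI allI)
qed

text \<open>
  The classical functions \<open>p (1/t) exp (-1/t)\<close>, continued by zero to \<open>t \<le> 0\<close>. Keeping the
  polynomial \<open>p\<close> general makes the family closed under differentiation, so that smoothness
  follows by induction.
\<close>

definition flat_exp :: "real poly \<Rightarrow> real \<Rightarrow> real" where
  "flat_exp p t = (if t \<le> 0 then 0 else poly p (inverse t) * exp (- inverse t))"

lemma poly_div_exp_tendsto_0: "((\<lambda>s::real. poly p s * exp (- s)) \<longlongrightarrow> 0) at_top"
proof -
  have "((\<lambda>s. \<Sum>i\<le>degree p. coeff p i * (s ^ i / exp s)) \<longlongrightarrow> (\<Sum>i\<le>degree p. coeff p i * 0)) at_top"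
    by (intro tendsto_intros tendsto_power_div_exp_0)
  then show ?thesis
    by (simp add: poly_altdef sum_distrib_right exp_minus divide_inverse mult.assoc)
qed

lemma flat_exp_deriv:
  "(flat_exp p has_real_derivative flat_exp ([:0, 0, 1:] * (p - pderiv p)) t) (at t)"
proof -
  consider "t < 0" | "t = 0" | "t > 0" by linarith
  then show ?thesis
  proof cases
    case 1
    have "(flat_exp p has_real_derivative 0) (at t)"
      by (rule has_field_derivative_transform_within_open[of "\<lambda>t. 0" _ _ "{..<0}"])
        (use 1 in \<open>auto simp: flat_exp_def\<close>)
    then show ?thesis using 1 by (simp add: flat_exp_def)
  next
    case 2
    have "((\<lambda>h. flat_exp p h / h) \<longlongrightarrow> 0) (at 0)"
    proof (rule filterlim_split_at)
      show "((\<lambda>h. flat_exp p h / h) \<longlongrightarrow> 0) (at_left 0)"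
        by (rule tendsto_eventually) (auto simp: eventually_at_filter flat_exp_def)
      have "((\<lambda>s. flat_exp p (inverse s) / inverse s) \<longlongrightarrow> 0) at_top"
        using poly_div_exp_tendsto_0[of "pCons 0 p"]
      proof (rule Lim_transform_eventually)
        show "\<forall>\<^sub>F s in at_top. poly (pCons 0 p) s * exp (- s) = flat_exp p (inverse s) / inverse s"
          using eventually_gt_at_top[of "0::real"]
          by eventually_elim (simp add: flat_exp_def field_simps)
      qed
      then show "((\<lambda>h. flat_exp p h / h) \<longlongrightarrow> 0) (at_right 0)"
        by (simp add: filterlim_at_right_to_top)
    qed
    then show ?thesis using 2 by (simp add: DERIV_def flat_exp_def)
  next
    case 3
    have "((\<lambda>t. poly p (inverse t) * exp (- inverse t)) has_real_derivative
        flat_exp ([:0, 0, 1:] * (p - pderiv p)) t) (at t)"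
      using 3
      by (auto intro!: derivative_eq_intros DERIV_chain2[OF poly_DERIV]
          simp: flat_exp_def power2_eq_square algebra_simps)
    then show ?thesis
      by (rule has_field_derivative_transform_within_open[where S="{0<..}"])
        (use 3 in \<open>auto simp: flat_exp_def\<close>)
  qed
qed

lemma real_Ck_flat_exp: "real_Ck k (flat_exp p)"
proof (induction k arbitrary: p)
  case 0
  show ?case using flat_exp_deriv
    by (auto simp: continuous_on_eq_continuous_at intro: DERIV_isCont)
next
  case (Suc k)
  then show ?case using flat_exp_deriv by auto
qed

lemma Ck_tensor_product:
  assumes "real_Ck k f" "real_Ck k g"
  shows "Ck k (\<lambda>x::real^2. f (x $ 1) * g (x $ 2))"
  using assms
proof (induction k arbitrary: f g)
  case 0
  then show ?case
    by (auto intro!: continuous_intros intro: continuous_on_compose2[of UNIV f] continuous_on_compose2[of UNIV g])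
next
  case (Suc k)
  then obtain f' g' where *: "\<And>t. (f has_real_derivative f' t) (at t)" "real_Ck k f'"
    "\<And>t. (g has_real_derivative g' t) (at t)" "real_Ck k g'" by auto
  have f: "((\<lambda>x::real^2. f (x $ 1)) has_derivative (\<lambda>h. h $ 1 * f' (x $ 1))) (at x)" for x
    by (rule DERIV_compose_FDERIV[OF *(1)]) (auto intro!: derivative_eq_intros bounded_linear_imp_has_derivative bounded_linear_vec_nth)
  have g: "((\<lambda>x::real^2. g (x $ 2)) has_derivative (\<lambda>h. h $ 2 * g' (x $ 2))) (at x)" for x
    by (rule DERIV_compose_FDERIV[OF *(3)]) (auto intro!: derivative_eq_intros bounded_linear_imp_has_derivative bounded_linear_vec_nth)
  have der: "((\<lambda>x::real^2. f (x $ 1) * g (x $ 2)) has_derivative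
      (\<lambda>h. f (x $ 1) * (h $ 2 * g' (x $ 2)) + (h $ 1 * f' (x $ 1)) * g (x $ 2))) (at x)" for x
    by (rule has_derivative_mult[OF f g])
  have pd: "partial_deriv 1 (\<lambda>x::real^2. f (x $ 1) * g (x $ 2)) = (\<lambda>x. f' (x $ 1) * g (x $ 2))"
    "partial_deriv 2 (\<lambda>x::real^2. f (x $ 1) * g (x $ 2)) = (\<lambda>x. f (x $ 1) * g' (x $ 2))"
    unfolding partial_deriv_def frechet_derivative_at[OF der, symmetric]
    by (auto simp: axis_def)
  have "Ck k (partial_deriv i (\<lambda>x::real^2. f (x $ 1) * g (x $ 2)))" for i
  proof -
    have "Ck k (\<lambda>x::real^2. f' (x $ 1) * g (x $ 2))"
      by (rule Suc.IH[OF *(2) real_Ck_Suc_imp[OF Suc.prems(2)]])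
    moreover have "Ck k (\<lambda>x::real^2. f (x $ 1) * g' (x $ 2))"
      by (rule Suc.IH[OF real_Ck_Suc_imp[OF Suc.prems(1)] *(4)])
    ultimately show ?thesis using exhaust_2[of i] pd by (elim disjE) simp_all
  qed
  moreover have "(\<lambda>x::real^2. f (x $ 1) * g (x $ 2)) differentiable at x" for x
    using der differentiable_def by blast
  ultimately show ?case by simp
qed

text \<open>
  In each coordinate take \<open>e (n (t - a)) e (n (b - t))\<close> with \<open>e t = exp (-1/t)\<close> for \<open>t > 0\<close> and
  \<open>e t = 0\<close> otherwise. As \<open>n\<close> grows both factors tend to 1 inside the interval, while they
  vanish outside of it for every \<open>n\<close>.
\<close>

lemma box_indicator_approximation:
  fixes a b :: "real^2"
  assumes "cbox a b \<subseteq> \<Omega>"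
  obtains \<phi> where "\<And>n. test_function \<Omega> (\<phi> n)" "\<And>n x. \<bar>\<phi> n x\<bar> \<le> 1"
    "\<And>x. (\<lambda>n::nat. \<phi> n x) \<longlonglongrightarrow> indicator (box a b) x"
proof -
  define e where "e = flat_exp 1"
  have e01: "0 \<le> e t" "e t \<le> 1" for t by (auto simp: e_def flat_exp_def)
  have e0: "e t = 0" if "t \<le> 0" for t using that by (simp add: e_def flat_exp_def)
  have lim: "(\<lambda>n. e (real (Suc n) * t)) \<longlonglongrightarrow> indicator {0<..} t" for t
  proof (cases "t > 0")
    case True
    have "(\<lambda>n. exp (- (inverse (real (Suc n)) * inverse t))) \<longlonglongrightarrow> exp (- (0 * inverse t))"
      by (intro tendsto_intros LIMSEQ_inverse_real_of_nat)
    then show ?thesis using True by (simp add: e_def flat_exp_def zero_less_mult_iff mult_le_0_iff del: of_nat_Suc)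
  qed (simp add: e0 mult_nonneg_nonpos)
  \<comment> \<open>The arguments are spelled out as affine functions of \<open>t\<close> to make smoothness immediate.\<close>
  define \<beta> where "\<beta> n c d t = e (real (Suc n) * t + (- real (Suc n) * c)) * e (- real (Suc n) * t + real (Suc n) * d)" for n c d t
  have \<beta>eq: "\<beta> n c d t = e (real (Suc n) * (t - c)) * e (real (Suc n) * (d - t))" for n c d t
    by (simp add: \<beta>_def algebra_simps)
  have \<beta>C: "real_Ck k (\<beta> n c d)" for k n c d
    unfolding \<beta>_def e_def by (intro real_Ck_mult real_Ck_affine real_Ck_flat_exp)
  have \<beta>01: "0 \<le> \<beta> n c d t" "\<beta> n c d t \<le> 1" for n c d t
    unfolding \<beta>eq using e01 by (auto intro: mult_le_one)
  have \<beta>0: "c < t \<and> t < d" if "\<beta> n c d t \<noteq> 0" for n c d t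
  proof (rule ccontr)
    assume "\<not> (c < t \<and> t < d)"
    then have "real (Suc n) * (t - c) \<le> 0 \<or> real (Suc n) * (d - t) \<le> 0"
      by (auto simp: not_less mult_le_0_iff)
    then show False using that e0 by (auto simp: \<beta>eq)
  qed
  have \<beta>lim: "(\<lambda>n. \<beta> n c d t) \<longlonglongrightarrow> indicator {c<..<d} t" for c d t
  proof -
    have "indicator {0<..} (t - c) * indicator {0<..} (d - t) = (indicator {c<..<d} t :: real)"
      by (auto simp: indicator_def)
    then show ?thesis using tendsto_mult[OF lim[of "t - c"] lim[of "d - t"]] by (simp add: \<beta>eq)
  qed
  define \<phi> where "\<phi> n x = \<beta> n (a$1) (b$1) (x$1) * \<beta> n (a$2) (b$2) (x$2)" for n and x :: "real^2"
  have box: "x \<in> box a b \<longleftrightarrow> (a$1 < x$1 \<and> x$1 < b$1) \<and> (a$2 < x$2 \<and> x$2 < b$2)" for x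
    by (auto simp: mem_box_cart forall_2)
  have supp: "closure {x. \<phi> n x \<noteq> 0} \<subseteq> cbox a b" for n
  proof (rule closure_minimal)
    show "{x. \<phi> n x \<noteq> 0} \<subseteq> cbox a b"
      using \<beta>0 box_subset_cbox by (fastforce simp: \<phi>_def box)
  qed (rule closed_cbox)
  show ?thesis
  proof (rule that[of \<phi>])
    fix n
    have "Ck k (\<phi> n)" for k unfolding \<phi>_def by (rule Ck_tensor_product; rule \<beta>C)
    moreover have "compact (closure {x. \<phi> n x \<noteq> 0})"
      using bounded_subset[OF bounded_cbox supp[of n]] by (simp add: compact_eq_bounded_closed)
    ultimately show "test_function \<Omega> (\<phi> n)" using supp[of n] assms by (auto simp: test_function_def)
  next
    fix n x show "\<bar>\<phi> n x\<bar> \<le> 1"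
      unfolding \<phi>_def using \<beta>01 by (auto simp: abs_mult intro!: mult_le_one)
  next
    fix x
    have "(\<lambda>n. \<phi> n x) \<longlonglongrightarrow> indicator {a$1<..<b$1} (x$1) * indicator {a$2<..<b$2} (x$2)"
      unfolding \<phi>_def by (intro tendsto_mult \<beta>lim)
    moreover have "indicator {a$1<..<b$1} (x$1) * indicator {a$2<..<b$2} (x$2) = (indicator (box a b) x :: real)"
      by (auto simp: indicator_def box)
    ultimately show "(\<lambda>n. \<phi> n x) \<longlonglongrightarrow> indicator (box a b) x" by simp
  qed
qed

text \<open>
  Boxes are closed under intersection and generate the Borel sets, so by Dynkin's argument \<open>u\<close>
  integrates to zero over every Borel set, in particular over the sets where it is positive
  and negative. To have Borel sets at hand, \<open>u\<close> is replaced by a Borel function that agrees with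
  it almost everywhere.
\<close>

lemma AE_zero_if_zero_on_boxes:
  fixes u :: "'a::euclidean_space \<Rightarrow> real"
  assumes u: "integrable lebesgue u" and total: "(LINT x|lebesgue. u x) = 0"
    and box: "\<And>a b. (LINT x|lebesgue. indicator (box a b) x * u x) = 0"
  shows "AE x in lebesgue. u x = 0"
proof -
  have um[measurable]: "u \<in> borel_measurable lebesgue" using u by auto
  have int: "integrable lebesgue (\<lambda>x. indicator S x * u x)" if "S \<in> sets borel" for S
    using integrable_mult_indicator[OF _ u, of S] that by simp
  have zero: "(LINT x|lebesgue. indicator S x * u x) = 0" if "S \<in> sets borel" for S
  proof -
    have "Int_stable (range (\<lambda>(a, b). box a b :: 'a set))"
      by (auto simp: Int_stable_def box_Int_box)
    moreover have "range (\<lambda>(a, b). box a b :: 'a set) \<subseteq> Pow UNIV" by simp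
    moreover have "S \<in> sigma_sets UNIV (range (\<lambda>(a, b). box a b))"
      using that by (simp add: borel_eq_box)
    ultimately show ?thesis
    proof (induction rule: sigma_sets_induct_disjoint)
      fix A :: "'a set" assume "A \<in> sigma_sets UNIV (range (\<lambda>(a, b). box a b))"
        and IH: "(LINT x|lebesgue. indicator A x * u x) = 0"
      then have A: "A \<in> sets borel" by (simp add: borel_eq_box)
      have "indicator (UNIV - A) x * u x = u x - indicator A x * u x" for x
        by (simp add: indicator_def)
      then show "(LINT x|lebesgue. indicator (UNIV - A) x * u x) = 0"
        using total IH int[OF A] u by simp
    next
      fix A :: "nat \<Rightarrow> 'a set" assume disj: "disjoint_family A"
        and "range A \<subseteq> sigma_sets UNIV (range (\<lambda>(a, b). box a b))"
        and IH: "\<And>i. (LINT x|lebesgue. indicator (A i) x * u x) = 0"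
      then have A: "A i \<in> sets borel" for i by (auto simp: borel_eq_box)
      have "(LINT x:(\<Union>i. A i)|lebesgue. u x) = (\<Sum>i. LINT x:A i|lebesgue. u x)"
      proof (rule lebesgue_integral_countable_add)
        show "set_integrable lebesgue (\<Union>i. A i) u"
          using int[of "\<Union>i. A i"] A by (auto simp: set_integrable_def)
      qed (use A disj in \<open>auto simp: disjoint_family_on_def\<close>)
      then show "(LINT x|lebesgue. indicator (\<Union>i. A i) x * u x) = 0"
        by (simp add: set_lebesgue_integral_def IH)
    qed (use box in auto)
  qed
  obtain u' where u'[measurable]: "u' \<in> borel_measurable lborel" and ae: "AE x in lborel. u x = u' x"
    using completion_ex_borel_measurable_real[OF um] by auto
  have ae': "AE x in lebesgue. u x = u' x" by (rule AE_completion[OF ae])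
  have u'm[measurable]: "u' \<in> borel_measurable lebesgue" by (rule measurable_completion) (rule u')
  have sets: "{x. u' x > 0} \<in> sets borel" "{x. u' x < 0} \<in> sets borel"
  proof -
    have "{x \<in> space lborel. u' x > 0} \<in> sets lborel" "{x \<in> space lborel. u' x < 0} \<in> sets lborel"
      by measurable
    then show "{x. u' x > 0} \<in> sets borel" "{x. u' x < 0} \<in> sets borel" by simp_all
  qed
  have part: "AE x in lebesgue. indicator S x * \<bar>u x\<bar> = 0" if S: "S \<in> sets borel"
    and sgn: "\<And>x. x \<in> S \<Longrightarrow> \<bar>u' x\<bar> = c * u' x" for S c
  proof -
    have "(LINT x|lebesgue. indicator S x * \<bar>u x\<bar>) = (LINT x|lebesgue. c * (indicator S x * u x))"
    proof (rule integral_cong_AE)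
      show "AE x in lebesgue. indicator S x * \<bar>u x\<bar> = c * (indicator S x * u x)"
        using ae' by eventually_elim (auto simp: indicator_def sgn)
    next
      have [measurable]: "S \<in> sets lebesgue" using S by simp
      show "(\<lambda>x. indicator S x * \<bar>u x\<bar>) \<in> borel_measurable lebesgue" by measurable
      show "(\<lambda>x. c * (indicator S x * u x)) \<in> borel_measurable lebesgue" by measurable
    qed
    also have "\<dots> = 0" using zero[OF S] by simp
    finally have 0: "(LINT x|lebesgue. indicator S x * \<bar>u x\<bar>) = 0" .
    have "integrable lebesgue (\<lambda>x. indicator S x * \<bar>u x\<bar>)"
      using integrable_abs[OF int[OF S]] by (simp add: abs_mult)
    from integral_nonneg_eq_0_iff_AE[OF this] 0 show ?thesis by simp
  qed
  have "AE x in lebesgue. indicator {x. u' x > 0} x * \<bar>u x\<bar> = 0"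
    by (rule part[where c=1]) (use sets in auto)
  moreover have "AE x in lebesgue. indicator {x. u' x < 0} x * \<bar>u x\<bar> = 0"
    by (rule part[where c="-1"]) (use sets in auto)
  ultimately show ?thesis using ae'
    by eventually_elim (auto simp: indicator_def split: if_splits)
qed

text \<open>
  The test functions approximating the indicator of a box show that \<open>w\<close> integrates to zero over
  every box whose closure lies in \<open>\<Omega>\<close>. Inside one such box the previous lemma applies, and
  countably many of them cover \<open>\<Omega>\<close>.
\<close>

lemma fundamental_lemma_calculus_of_variations:
  assumes \<Omega>: "open \<Omega>" "bounded \<Omega>" and w: "w \<in> L2 \<Omega>"
    and test: "\<And>\<phi>. test_function \<Omega> \<phi> \<Longrightarrow> (LINT x|lebesgue_on \<Omega>. w x * \<phi> x) = 0"
  shows "AE x in lebesgue_on \<Omega>. w x = 0"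
proof -
  have lm: "\<Omega> \<in> lmeasurable" using \<Omega> by (simp add: lmeasurable_open)
  then have \<Omega>s: "\<Omega> \<in> sets lebesgue" by (simp add: fmeasurableD)
  note [measurable] = L2_D(1)[OF w]
  have one: "(\<lambda>x. 1::real) \<in> L2 \<Omega>" by (rule L2_bounded_on_finite[OF lm, of _ 1]) auto
  have wint: "integrable (lebesgue_on \<Omega>) w" using L2_inner_integrable[OF w one] by simp
  have box0: "(LINT x|lebesgue_on \<Omega>. indicator (box a b) x * w x) = 0" if ab: "cbox a b \<subseteq> \<Omega>" for a b
  proof -
    obtain \<phi> where \<phi>: "\<And>n. test_function \<Omega> (\<phi> n)" "\<And>n x. \<bar>\<phi> n x\<bar> \<le> 1"
      "\<And>x. (\<lambda>n::nat. \<phi> n x) \<longlonglongrightarrow> indicator (box a b) x"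
      using box_indicator_approximation[OF ab] by blast
    have "Ck 0 (\<phi> n)" for n using \<phi>(1)[of n] unfolding test_function_def by blast
    then have [measurable]: "\<phi> n \<in> borel_measurable borel" for n
      by (intro borel_measurable_continuous_onI) simp
    have [measurable]: "\<phi> n \<in> borel_measurable (lebesgue_on \<Omega>)" for n
      by (intro measurable_restrict_space1 measurable_completion) simp
    have [measurable]: "indicator (box a b) \<in> borel_measurable (lebesgue_on \<Omega>)"
      by (intro measurable_restrict_space1 measurable_completion) simp
    have "(\<lambda>n. LINT x|lebesgue_on \<Omega>. w x * \<phi> n x) \<longlonglongrightarrow> (LINT x|lebesgue_on \<Omega>. indicator (box a b) x * w x)"
    proof (rule integral_dominated_convergence[where w="\<lambda>x. \<bar>w x\<bar>"])
      show "AE x in lebesgue_on \<Omega>. (\<lambda>n. w x * \<phi> n x) \<longlonglongrightarrow> indicator (box a b) x * w x"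
        using tendsto_mult[OF tendsto_const \<phi>(3)] by (simp add: mult.commute)
      show "AE x in lebesgue_on \<Omega>. norm (w x * \<phi> n x) \<le> \<bar>w x\<bar>" for n
        using \<phi>(2)[of n] by (auto simp: abs_mult intro!: AE_I2 mult_left_le)
    qed (use wint in auto)
    then show ?thesis using test[OF \<phi>(1)] by (simp add: LIMSEQ_const_iff)
  qed
  define W where "W x = indicator \<Omega> x * w x" for x
  have Wint: "integrable lebesgue W"
    unfolding W_def using wint \<Omega>s by (simp add: integrable_restrict_space)
  have loc: "AE x in lebesgue. x \<in> box a b \<longrightarrow> W x = 0" if ab: "cbox a b \<subseteq> \<Omega>" for a b
  proof -
    have sub: "(LINT x|lebesgue. indicator (box c d) x * W x) = 0" if "box c d \<subseteq> box a b" for c d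
    proof (cases "box c d = {}")
      case False
      have "closure (box c d) \<subseteq> cbox a b"
        using that box_subset_cbox[of a b] by (intro closure_minimal closed_cbox) blast
      then have "cbox c d \<subseteq> \<Omega>" using False ab by (simp add: closure_box)
      from box0[OF this] \<Omega>s show ?thesis
        by (simp add: integral_restrict_space W_def mult.left_commute)
    qed simp
    have eq: "indicator (box c d) x * (indicator (box a b) x * W x) = indicator (box c d \<inter> box a b) x * W x" for c d x
      by (simp add: indicator_def)
    have "AE x in lebesgue. indicator (box a b) x * W x = 0"
    proof (rule AE_zero_if_zero_on_boxes)
      show "integrable lebesgue (\<lambda>x. indicator (box a b) x * W x)"
        using integrable_mult_indicator[OF _ Wint, of "box a b"] by simp
      show "(LINT x|lebesgue. indicator (box a b) x * W x) = 0" by (rule sub) simp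
      show "(LINT x|lebesgue. indicator (box c d) x * (indicator (box a b) x * W x)) = 0" for c d
        unfolding eq box_Int_box by (rule sub) (simp add: box_Int_box[symmetric])
    qed
    then show ?thesis by eventually_elim (auto simp: indicator_def)
  qed
  obtain D where D: "countable D" "D \<subseteq> Pow \<Omega>" "\<And>X. X \<in> D \<Longrightarrow> \<exists>a b. X = cbox a b" "\<Union>D = \<Omega>"
    using open_countable_Union_open_cbox[OF \<Omega>(1)] by metis
  have "AE x in lebesgue. \<forall>X\<in>D. x \<in> X \<longrightarrow> W x = 0"
  proof (subst AE_ball_countable[OF D(1)], rule ballI)
    fix X assume X: "X \<in> D"
    then obtain a b where ab: "X = cbox a b" using D by blast
    have "AE x in lebesgue. x \<notin> cbox a b - box a b"
      using negligible_frontier_interval[of a b] by (intro AE_not_in) (simp add: negligible_iff_null_sets)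
    moreover have "AE x in lebesgue. x \<in> box a b \<longrightarrow> W x = 0"
      by (rule loc) (use X D(2) ab in auto)
    ultimately show "AE x in lebesgue. x \<in> X \<longrightarrow> W x = 0"
      by eventually_elim (auto simp: ab)
  qed
  then have "AE x in lebesgue. x \<in> \<Omega> \<longrightarrow> w x = 0"
    by eventually_elim (use D(4) in \<open>auto simp: W_def indicator_def\<close>)
  then show ?thesis using \<Omega>s by (simp add: AE_restrict_space_iff)
qed


section \<open>A bounded right inverse of the curl\<close>

lemma nn_integral_translate:
  assumes [measurable]: "f \<in> borel_measurable borel"
  shows "(\<integral>\<^sup>+x. f (x + c) \<partial>lborel) = (\<integral>\<^sup>+x. f x \<partial>(lborel :: 'a::euclidean_space measure))"
  by (subst (2) lborel_distr_plus[of c, symmetric]) (simp add: nn_integral_distr add.commute)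

lemma integral_translate:
  fixes f :: "'a::euclidean_space \<Rightarrow> real"
  assumes [measurable]: "f \<in> borel_measurable borel"
  shows "(LINT x|lborel. f (x + c)) = (LINT x|lborel. f x)"
  by (subst (2) lborel_distr_plus[of c, symmetric]) (simp add: integral_distr add.commute)

text \<open>
  Tonelli's theorem and translation invariance: integrating \<open>f\<close> along segments of direction \<open>e\<close>
  and length parameter \<open>D\<close> multiplies its total integral by \<open>D\<close>. Treating the shear
  \<open>(s, x) \<mapsto> x + s e\<close> with \<open>x\<close> in the plane avoids splitting the plane into its coordinate axes.
\<close>

lemma nn_integral_segment_averages:
  fixes e :: "'a::euclidean_space" and f :: "'a \<Rightarrow> ennreal"
  assumes [measurable]: "f \<in> borel_measurable borel" and D: "D \<ge> 0"
  shows "(\<integral>\<^sup>+x. (\<integral>\<^sup>+s. indicator {0..D} s * f (x + s *\<^sub>R e) \<partial>lborel) \<partial>lborel) = ennreal D * (\<integral>\<^sup>+x. f x \<partial>lborel)"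
proof -
  have "(\<integral>\<^sup>+x. (\<integral>\<^sup>+s. indicator {0..D} s * f (x + s *\<^sub>R e) \<partial>lborel) \<partial>lborel)
      = (\<integral>\<^sup>+s. (\<integral>\<^sup>+x. indicator {0..D} s * f (x + s *\<^sub>R e) \<partial>lborel) \<partial>lborel)"
    by (rule lborel_pair.Fubini') measurable
  also have "\<dots> = (\<integral>\<^sup>+s. indicator {0..D} s * (\<integral>\<^sup>+x. f x \<partial>lborel) \<partial>lborel)"
    by (simp add: nn_integral_cmult nn_integral_translate)
  also have "\<dots> = ennreal D * (\<integral>\<^sup>+x. f x \<partial>lborel)"
    using D by (simp add: nn_integral_multc)
  finally show ?thesis .
qed

text \<open>
  Justifies Fubini's theorem in the integration by parts below; the integrand is dominated by
  the sum of the squares of its two factors.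
\<close>

lemma integrable_segment_product:
  fixes e :: "'a::euclidean_space" and a b :: "'a \<Rightarrow> real"
  assumes [measurable]: "a \<in> borel_measurable borel" "b \<in> borel_measurable borel"
    and a: "integrable lborel (\<lambda>x. (a x)\<^sup>2)" and b: "integrable lborel (\<lambda>x. (b x)\<^sup>2)" and D: "D \<ge> 0"
  shows "integrable (lborel \<Otimes>\<^sub>M lborel) (\<lambda>(s, x). indicator {0..D} s * (a (x + s *\<^sub>R e) * b x))"
proof (rule integrableI_bounded)
  let ?f = "\<lambda>(s, x). indicator {0..D} s * (a (x + s *\<^sub>R e) * b x)"
  show [measurable]: "?f \<in> borel_measurable (lborel \<Otimes>\<^sub>M lborel)" by measurable
  have ptw: "ennreal (norm (indicator {0..D} s * (a (x + s *\<^sub>R e) * b x))) \<le>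
      indicator {0..D} s * ennreal ((a (x + s *\<^sub>R e))\<^sup>2) + indicator {0..D} s * ennreal ((b x)\<^sup>2)" for s x
  proof -
    have "\<bar>a (x + s *\<^sub>R e) * b x\<bar> \<le> (a (x + s *\<^sub>R e))\<^sup>2 + (b x)\<^sup>2"
    proof -
      have "0 \<le> (\<bar>a (x + s *\<^sub>R e)\<bar> - \<bar>b x\<bar>)\<^sup>2 + (a (x + s *\<^sub>R e))\<^sup>2 + (b x)\<^sup>2" by simp
      then show ?thesis by (simp add: power2_diff abs_mult)
    qed
    then show ?thesis by (auto simp: indicator_def ennreal_leI simp flip: ennreal_plus)
  qed
  have "(\<integral>\<^sup>+p. ennreal (norm (?f p)) \<partial>(lborel \<Otimes>\<^sub>M lborel))
      = (\<integral>\<^sup>+x. (\<integral>\<^sup>+s. ennreal (norm (indicator {0..D} s * (a (x + s *\<^sub>R e) * b x))) \<partial>lborel) \<partial>lborel)"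
    by (subst lborel_pair.nn_integral_snd[symmetric]) (auto simp: case_prod_unfold)
  also have "\<dots> \<le> (\<integral>\<^sup>+x. (\<integral>\<^sup>+s. indicator {0..D} s * ennreal ((a (x + s *\<^sub>R e))\<^sup>2)
        + indicator {0..D} s * ennreal ((b x)\<^sup>2) \<partial>lborel) \<partial>lborel)"
    by (intro nn_integral_mono ptw)
  also have "\<dots> = (\<integral>\<^sup>+x. (\<integral>\<^sup>+s. indicator {0..D} s * ennreal ((a (x + s *\<^sub>R e))\<^sup>2) \<partial>lborel)
        + ennreal D * ennreal ((b x)\<^sup>2) \<partial>lborel)"
    using D by (intro nn_integral_cong) (simp add: nn_integral_add nn_integral_multc)
  also have "\<dots> = (\<integral>\<^sup>+x. (\<integral>\<^sup>+s. indicator {0..D} s * ennreal ((a (x + s *\<^sub>R e))\<^sup>2) \<partial>lborel) \<partial>lborel)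
        + (\<integral>\<^sup>+x. ennreal D * ennreal ((b x)\<^sup>2) \<partial>lborel)"
    by (rule nn_integral_add) measurable
  also have "\<dots> = ennreal D * (\<integral>\<^sup>+x. ennreal ((a x)\<^sup>2) \<partial>lborel) + ennreal D * (\<integral>\<^sup>+x. ennreal ((b x)\<^sup>2) \<partial>lborel)"
    using D by (subst nn_integral_segment_averages) (auto simp: nn_integral_cmult)
  also have "\<dots> < \<infinity>"
    using a b by (simp add: nn_integral_eq_integral ennreal_mult_less_top)
  finally show "(\<integral>\<^sup>+p. ennreal (norm (?f p)) \<partial>(lborel \<Otimes>\<^sub>M lborel)) < \<infinity>" .
qed

lemma test_function_zero: "test_function \<Omega> \<phi> \<Longrightarrow> x \<notin> \<Omega> \<Longrightarrow> \<phi> x = 0"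
  using closure_subset[of "{x. \<phi> x \<noteq> 0}"] by (auto simp: test_function_def)

lemma partial_deriv_zero_off_support:
  assumes "x \<notin> closure {x. \<phi> x \<noteq> 0}"
  shows "partial_deriv i \<phi> x = 0"
proof -
  have "((\<lambda>x. 0) has_derivative (\<lambda>h. 0)) (at x)" by simp
  then have "(\<phi> has_derivative (\<lambda>h. 0)) (at x)"
    by (rule has_derivative_transform_within_open[where s="- closure {x. \<phi> x \<noteq> 0}"])
      (use assms closure_subset[of "{x. \<phi> x \<noteq> 0}"] in auto)
  from fun_cong[OF frechet_derivative_at[OF this], of "axis i 1"] show ?thesis
    by (simp add: partial_deriv_def)
qed

lemma test_function_smooth:
  assumes "test_function \<Omega> \<phi>"
  shows "\<phi> differentiable (at x)" "continuous_on UNIV \<phi>" "continuous_on UNIV (partial_deriv i \<phi>)"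
proof -
  have "Ck (Suc 0) \<phi>" "Ck 0 \<phi>" using assms unfolding test_function_def by blast+
  then show "\<phi> differentiable (at x)" "continuous_on UNIV \<phi>" "continuous_on UNIV (partial_deriv i \<phi>)" by auto
qed

lemma compact_support_square_integrable:
  fixes f :: "'a::euclidean_space \<Rightarrow> 'b::euclidean_space"
  assumes f: "continuous_on UNIV f" and K: "compact K" and zero: "\<And>x. x \<notin> K \<Longrightarrow> f x = 0"
  shows "integrable lborel (\<lambda>x. (norm (f x))\<^sup>2)"
proof -
  have "integrable lborel (\<lambda>x. indicator K x *\<^sub>R (norm (f x))\<^sup>2)"
    by (intro borel_integrable_compact K continuous_intros continuous_on_subset[OF f]) auto
  also have "(\<lambda>x. indicator K x *\<^sub>R (norm (f x))\<^sup>2) = (\<lambda>x. (norm (f x))\<^sup>2)"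
    by (auto simp: fun_eq_iff indicator_def zero)
  finally show ?thesis .
qed

lemma compact_support_in_L2:
  fixes f :: "real^2 \<Rightarrow> 'b::euclidean_space"
  assumes \<Omega>: "\<Omega> \<in> sets lebesgue"
    and f: "continuous_on UNIV f" and K: "compact K" and zero: "\<And>x. x \<notin> K \<Longrightarrow> f x = 0"
  shows "f \<in> L2 \<Omega>"
proof (rule L2_I)
  have [measurable]: "f \<in> borel_measurable borel" using f by (intro borel_measurable_continuous_onI)
  show "f \<in> borel_measurable (lebesgue_on \<Omega>)"
    by (intro measurable_restrict_space1 measurable_completion) simp
  have "integrable lebesgue (\<lambda>x. (norm (f x))\<^sup>2)"
    using compact_support_square_integrable[OF f K zero] by (subst integrable_completion) auto
  from integrable_mult_indicator[OF \<Omega> this]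
  show "integrable (lebesgue_on \<Omega>) (\<lambda>x. (norm (f x))\<^sup>2)"
    using \<Omega> by (simp add: integrable_restrict_space)
qed

lemma test_function_in_L2:
  assumes "\<Omega> \<in> sets lebesgue" "test_function \<Omega> \<phi>"
  shows "\<phi> \<in> L2 \<Omega>" "partial_deriv i \<phi> \<in> L2 \<Omega>"
proof -
  note K = compact_support_in_L2[OF assms(1), where K="closure {x. \<phi> x \<noteq> 0}"]
  have "compact (closure {x. \<phi> x \<noteq> 0})" using assms(2) by (simp add: test_function_def)
  then show "\<phi> \<in> L2 \<Omega>" "partial_deriv i \<phi> \<in> L2 \<Omega>"
    using closure_subset[of "{x. \<phi> x \<noteq> 0}"]
    by (auto intro!: K test_function_smooth[OF assms(2)] partial_deriv_zero_off_support)
qed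

lemma test_function_segment_integral:
  assumes \<phi>: "test_function \<Omega> \<phi>" and D: "D \<ge> 0"
  shows "(LINT s|lborel. indicator {0..D} s * partial_deriv i \<phi> (x + s *\<^sub>R axis i 1)) = \<phi> (x + D *\<^sub>R axis i 1) - \<phi> x"
proof -
  let ?F = "\<lambda>s. \<phi> (x + s *\<^sub>R axis i 1)"
  have der: "(?F has_vector_derivative partial_deriv i \<phi> (x + s *\<^sub>R axis i 1)) (at s within {0..D})" for s
  proof -
    have 1: "(\<phi> has_derivative frechet_derivative \<phi> (at (x + s *\<^sub>R axis i 1))) (at (x + s *\<^sub>R axis i 1))"
      using test_function_smooth(1)[OF \<phi>] frechet_derivative_works by blast
    have 2: "((\<lambda>s. x + s *\<^sub>R axis i 1) has_derivative (\<lambda>h. h *\<^sub>R axis i 1)) (at s within {0..D})"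
      by (auto intro!: derivative_eq_intros)
    have "(?F has_derivative (\<lambda>h. frechet_derivative \<phi> (at (x + s *\<^sub>R axis i 1)) (h *\<^sub>R axis i 1))) (at s within {0..D})"
      using has_derivative_compose[OF 2 1] .
    then show ?thesis
      unfolding has_vector_derivative_def partial_deriv_def
      by (simp add: linear_cmul[OF has_derivative_linear[OF 1]])
  qed
  have cont: "continuous_on {0..D} (\<lambda>s. partial_deriv i \<phi> (x + s *\<^sub>R axis i 1))"
    by (intro continuous_on_compose2[OF test_function_smooth(3)[OF \<phi>]] continuous_intros) auto
  show ?thesis
    using integral_FTC_Icc[OF D der cont] by simp
qed

text \<open>
  Extend \<open>q\<close> by zero and integrate in the second coordinate direction \<open>e\<close>: the field
  \<open>v = (F, 0)\<close> with \<open>F x = \<integral>\<^sub>0\<^sup>D q (x - s e) ds\<close> satisfies \<open>\<partial>\<^sub>2 F = q\<close> on \<open>\<Omega>\<close> once \<open>D\<close> exceeds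
  the diameter, because then \<open>x + D e\<close> is outside \<open>\<Omega>\<close> for all \<open>x\<close> in \<open>\<Omega>\<close>. Weakly, after Fubini and a
  translation, \<open>\<integral> F \<partial>\<^sub>2\<phi> = \<integral> q (\<phi> (x + D e) - \<phi> x) dx = - \<integral> q \<phi>\<close>. Cauchy--Schwarz on the
  segments bounds the norm of \<open>F\<close> by \<open>D\<close> times that of \<open>q\<close>.
\<close>

lemma curl_bounded_right_inverse:
  assumes \<Omega>: "open \<Omega>" "bounded \<Omega>"
  shows "\<exists>c>0. \<forall>q\<in>L2 \<Omega>. \<exists>v\<in>L2 \<Omega>. has_weak_curl \<Omega> v q \<and> L2_norm \<Omega> v \<le> c * L2_norm \<Omega> q"
proof -
  define e :: "real^2" where "e = axis 2 1"
  have ne: "norm e = 1" by (simp add: e_def)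
  obtain R where R: "R > 0" "\<And>x. x \<in> \<Omega> \<Longrightarrow> norm x \<le> R"
    using \<Omega>(2) by (auto simp: bounded_pos)
  \<comment> \<open>More than \<open>2 R\<close>, the diameter of the ball containing \<open>\<Omega>\<close>.\<close>
  define D where "D = 3 * R"
  have D: "D > 0" "D \<ge> 0" using R by (auto simp: D_def)
  have shift: "x + D *\<^sub>R e \<notin> \<Omega>" if "x \<in> \<Omega>" for x
  proof
    assume "x + D *\<^sub>R e \<in> \<Omega>"
    from R(2)[OF this] R(2)[OF that] norm_triangle_ineq4[of "x + D *\<^sub>R e" x] ne R(1)
    show False by (simp add: D_def)
  qed
  have \<Omega>s: "\<Omega> \<in> sets lebesgue" using \<Omega> by simp
  show ?thesis
  proof (intro exI[of _ D] conjI ballI)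
    fix q :: "real^2 \<Rightarrow> real" assume q: "q \<in> L2 \<Omega>"
    have ind: "(\<lambda>x. indicator \<Omega> x * q x) \<in> L2 UNIV"
      using ext_in_L2_iff[OF \<Omega>s, of q] q by simp
    then have "(\<lambda>x. indicator \<Omega> x * q x) \<in> borel_measurable lebesgue" by (auto dest: L2_D)
    from completion_ex_borel_measurable_real[OF this]
    obtain r where rm: "r \<in> borel_measurable lborel" and ae: "AE x in lborel. indicator \<Omega> x * q x = r x"
      by blast
    then have r [measurable]: "r \<in> borel_measurable borel" by simp
    have ae': "AE x in lebesgue. indicator \<Omega> x * q x = r x" by (rule AE_completion[OF ae])
    have rl: "r \<in> borel_measurable lebesgue" by (rule measurable_completion) (rule rm)
    have rL: "r \<in> L2 UNIV"
    proof (rule L2_bound[OF _ ind])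
      show "AE x in lebesgue_on UNIV. norm (r x) \<le> 1 * norm (indicator \<Omega> x * q x)"
        unfolding lebesgue_on_UNIV_eq using ae' by eventually_elim simp
    qed (use rl in simp)
    then have r2: "integrable lborel (\<lambda>x. (r x)\<^sup>2)"
      using L2_D(2)[OF rL] by (simp add: integrable_completion)
    have nr: "(\<integral>\<^sup>+x. ennreal ((r x)\<^sup>2) \<partial>lborel) = ennreal ((L2_norm \<Omega> q)\<^sup>2)"
    proof -
      have "(\<integral>\<^sup>+x. ennreal ((r x)\<^sup>2) \<partial>lborel) = (\<integral>\<^sup>+x. ennreal ((norm (r x))\<^sup>2) \<partial>lebesgue)"
        by (simp add: nn_integral_completion)
      also have "\<dots> = ennreal ((norm (cls_l2 r))\<^sup>2)" by (rule nn_integral_norm_cls_l2[OF rL])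
      also have "cls_l2 r = ext_l2 \<Omega> q"
        using ae' ind rL by (simp add: ext_l2_def cls_l2_eq_iff eq_commute)
      also have "norm (ext_l2 \<Omega> q) = L2_norm \<Omega> q" by (rule norm_ext_l2[OF \<Omega>s q])
      finally show ?thesis .
    qed
    \<comment> \<open>Fubini's theorem needs a Borel function, hence \<open>r\<close> in place of the zero extension of \<open>q\<close>.\<close>
    define F where "F x = (LINT s|lborel. indicator {0..D} s * r (x + s *\<^sub>R - e))" for x
    have Fm [measurable]: "F \<in> borel_measurable borel"
    proof -
      have "F \<in> borel_measurable lborel"
        unfolding F_def by (rule lborel.borel_measurable_lebesgue_integral) measurable
      then show ?thesis by simp
    qed
    have Fptw: "ennreal ((F x)\<^sup>2) \<le> ennreal D * (\<integral>\<^sup>+s. indicator {0..D} s * ennreal ((r (x + s *\<^sub>R - e))\<^sup>2) \<partial>lborel)" for x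
    proof (cases "integrable lborel (\<lambda>s. indicator {0..D} s * r (x + s *\<^sub>R - e))")
      case True
      have "ennreal ((F x)\<^sup>2) = (ennreal (norm (F x)))\<^sup>2" by (simp add: ennreal_power)
      also have "\<dots> \<le> (\<integral>\<^sup>+s. ennreal (norm (indicator {0..D} s * r (x + s *\<^sub>R - e))) \<partial>lborel)\<^sup>2"
        unfolding F_def by (intro power_mono integral_norm_bound_ennreal[OF True]) simp
      also have "\<dots> = (\<integral>\<^sup>+s. indicator {0..D} s * (indicator {0..D} s * ennreal \<bar>r (x + s *\<^sub>R - e)\<bar>) \<partial>lborel)\<^sup>2"
        by (intro arg_cong[where f="\<lambda>t. t\<^sup>2"] nn_integral_cong) (simp add: indicator_def)
      also have "\<dots> \<le> (\<integral>\<^sup>+s. (indicator {0..D} s)\<^sup>2 \<partial>lborel) * (\<integral>\<^sup>+s. (indicator {0..D} s * ennreal \<bar>r (x + s *\<^sub>R - e)\<bar>)\<^sup>2 \<partial>lborel)"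
        by (rule Cauchy_Schwarz_nn_integral) measurable
      also have "(\<integral>\<^sup>+s. (indicator {0..D} s)\<^sup>2 \<partial>lborel) = (\<integral>\<^sup>+s. indicator {0..D} s \<partial>lborel)"
        by (intro nn_integral_cong) (simp add: indicator_def)
      also have "\<dots> = ennreal D" using D by simp
      also have "(\<integral>\<^sup>+s. (indicator {0..D} s * ennreal \<bar>r (x + s *\<^sub>R - e)\<bar>)\<^sup>2 \<partial>lborel)
          = (\<integral>\<^sup>+s. indicator {0..D} s * ennreal ((r (x + s *\<^sub>R - e))\<^sup>2) \<partial>lborel)"
        by (intro nn_integral_cong) (simp add: indicator_def ennreal_power)
      finally show ?thesis .
    next
      case False
      then have "F x = 0" unfolding F_def by (rule not_integrable_integral_eq)
      then show ?thesis by simp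
    qed
    have Fint: "(\<integral>\<^sup>+x. ennreal ((F x)\<^sup>2) \<partial>lborel) \<le> ennreal ((D * L2_norm \<Omega> q)\<^sup>2)"
    proof -
      have "(\<integral>\<^sup>+x. ennreal ((F x)\<^sup>2) \<partial>lborel)
        \<le> (\<integral>\<^sup>+x. ennreal D * (\<integral>\<^sup>+s. indicator {0..D} s * ennreal ((r (x + s *\<^sub>R - e))\<^sup>2) \<partial>lborel) \<partial>lborel)"
        by (intro nn_integral_mono Fptw)
      also have "\<dots> = ennreal D * (ennreal D * (\<integral>\<^sup>+x. ennreal ((r x)\<^sup>2) \<partial>lborel))"
        by (subst nn_integral_cmult, measurable, subst nn_integral_segment_averages) (use D in auto)
      also have "\<dots> = ennreal ((D * L2_norm \<Omega> q)\<^sup>2)"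
        unfolding nr using D by (simp add: ennreal_mult[symmetric] power_mult_distrib power2_eq_square mult_ac)
      finally show ?thesis .
    qed
    have F2: "integrable lborel (\<lambda>x. (F x)\<^sup>2)"
      by (rule integrableI_bounded) (use Fint in \<open>auto simp: le_less_trans\<close>)
    define v :: "real^2 \<Rightarrow> real^2" where "v x = F x *\<^sub>R axis 1 1" for x
    have FL: "F \<in> L2 UNIV"
      by (rule L2_I) (use F2 in \<open>auto simp: integrable_completion intro: measurable_completion\<close>)
    have Flm: "F \<in> borel_measurable lebesgue" by (rule measurable_completion) simp
    have vm: "v \<in> borel_measurable (lebesgue_on \<Omega>)"
      unfolding v_def by (intro borel_measurable_scaleR measurable_restrict_space1 Flm) simp
    have FO: "F \<in> L2 \<Omega>"
    proof (rule L2_I)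
      show "integrable (lebesgue_on \<Omega>) (\<lambda>x. (norm (F x))\<^sup>2)"
        using integrable_mult_indicator[OF \<Omega>s, of "\<lambda>x. (F x)\<^sup>2"] L2_D(2)[OF FL] \<Omega>s
        by (simp add: integrable_restrict_space)
    qed (intro measurable_restrict_space1 Flm)
    have vL: "v \<in> L2 \<Omega>"
      by (rule L2_bound[OF vm FO, of 1]) (simp add: v_def)
    have "has_weak_curl \<Omega> v q"
      unfolding has_weak_curl_def
    proof (intro allI impI)
      fix \<phi> assume \<phi>: "test_function \<Omega> \<phi>"
      define \<psi> where "\<psi> = partial_deriv 2 \<phi>"
      have \<psi>c: "continuous_on UNIV \<psi>" and \<phi>c: "continuous_on UNIV \<phi>"
        using test_function_smooth[OF \<phi>] by (auto simp: \<psi>_def)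
      have [measurable]: "\<psi> \<in> borel_measurable borel" "\<phi> \<in> borel_measurable borel"
        using \<psi>c \<phi>c by (auto intro: borel_measurable_continuous_onI)
      have K: "compact (closure {x. \<phi> x \<noteq> 0})" "closure {x. \<phi> x \<noteq> 0} \<subseteq> \<Omega>"
        using \<phi> by (auto simp: test_function_def)
      have \<psi>0: "\<psi> x = 0" if "x \<notin> closure {x. \<phi> x \<noteq> 0}" for x
        unfolding \<psi>_def by (rule partial_deriv_zero_off_support[OF that])
      have \<psi>2: "integrable lborel (\<lambda>x. (\<psi> x)\<^sup>2)"
        using compact_support_square_integrable[OF \<psi>c K(1) \<psi>0] by simp
      have "(LINT x|lebesgue_on \<Omega>. v x $ 2 * partial_deriv 1 \<phi> x - v x $ 1 * partial_deriv 2 \<phi> x)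
          = - (LINT x|lebesgue_on \<Omega>. F x * \<psi> x)"
        by (simp add: v_def \<psi>_def axis_def)
      also have "(LINT x|lebesgue_on \<Omega>. F x * \<psi> x) = (LINT x|lebesgue. indicator \<Omega> x *\<^sub>R (F x * \<psi> x))"
        using \<Omega>s by (simp add: integral_restrict_space)
      also have "\<dots> = (LINT x|lebesgue. F x * \<psi> x)"
        using \<psi>0 K(2) by (intro Bochner_Integration.integral_cong refl) (auto simp: indicator_def)
      also have "\<dots> = (LINT x|lborel. F x * \<psi> x)"
        by (rule integral_completion) measurable
      also have "\<dots> = (LINT x|lborel. (LINT s|lborel. indicator {0..D} s * (r (x + s *\<^sub>R - e) * \<psi> x)))"
        by (simp add: F_def mult.assoc flip: integral_mult_left_zero)
      also have "\<dots> = (LINT s|lborel. (LINT x|lborel. indicator {0..D} s * (r (x + s *\<^sub>R - e) * \<psi> x)))"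
        by (rule lborel_pair.Fubini_integral) (rule integrable_segment_product[OF _ _ r2 \<psi>2 D(2)]; measurable)
      also have "\<dots> = (LINT s|lborel. (LINT x|lborel. indicator {0..D} s * (\<psi> (x + s *\<^sub>R e) * r x)))"
      proof (rule Bochner_Integration.integral_cong[OF refl])
        fix s
        show "(LINT x|lborel. indicator {0..D} s * (r (x + s *\<^sub>R - e) * \<psi> x))
          = (LINT x|lborel. indicator {0..D} s * (\<psi> (x + s *\<^sub>R e) * r x))"
          using integral_translate[of "\<lambda>x. indicator {0..D} s * (r (x + s *\<^sub>R - e) * \<psi> x)" "s *\<^sub>R e"]
          by (simp add: mult_ac)
      qed
      also have "\<dots> = (LINT x|lborel. (LINT s|lborel. indicator {0..D} s * (\<psi> (x + s *\<^sub>R e) * r x)))"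
        by (rule lborel_pair.Fubini_integral[symmetric]) (rule integrable_segment_product[OF _ _ \<psi>2 r2 D(2)]; measurable)
      also have "\<dots> = (LINT x|lborel. (LINT s|lborel. indicator {0..D} s * \<psi> (x + s *\<^sub>R e)) * r x)"
        by (simp add: mult.assoc flip: integral_mult_left_zero)
      also have "\<dots> = (LINT x|lborel. (\<phi> (x + D *\<^sub>R e) - \<phi> x) * r x)"
        using test_function_segment_integral[OF \<phi> D(2), of 2] by (simp add: \<psi>_def e_def)
      also have "\<dots> = (LINT x|lebesgue. (\<phi> (x + D *\<^sub>R e) - \<phi> x) * r x)"
        by (rule integral_completion[symmetric]) measurable
      also have "\<dots> = (LINT x|lebesgue. - (indicator \<Omega> x *\<^sub>R (q x * \<phi> x)))"
      proof (rule integral_cong_AE)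
        show "AE x in lebesgue. (\<phi> (x + D *\<^sub>R e) - \<phi> x) * r x = - (indicator \<Omega> x *\<^sub>R (q x * \<phi> x))"
          using ae'
        proof eventually_elim
          fix x assume eq: "indicator \<Omega> x * q x = r x"
          show "(\<phi> (x + D *\<^sub>R e) - \<phi> x) * r x = - (indicator \<Omega> x *\<^sub>R (q x * \<phi> x))"
            using test_function_zero[OF \<phi> shift] by (cases "x \<in> \<Omega>") (auto simp flip: eq)
        qed
        show "(\<lambda>x. (\<phi> (x + D *\<^sub>R e) - \<phi> x) * r x) \<in> borel_measurable lebesgue"
          by (rule measurable_completion) measurable
        have "\<phi> \<in> borel_measurable lebesgue" by (rule measurable_completion) simp
        with L2_D(1)[OF ind] have "(\<lambda>x. (indicator \<Omega> x * q x) * \<phi> x) \<in> borel_measurable lebesgue"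
          by (intro borel_measurable_times[of "\<lambda>x. indicator \<Omega> x * q x"]) simp_all
        then show "(\<lambda>x. - (indicator \<Omega> x *\<^sub>R (q x * \<phi> x))) \<in> borel_measurable lebesgue"
          by (simp add: mult.assoc)
      qed
      also have "\<dots> = - (LINT x|lebesgue_on \<Omega>. q x * \<phi> x)"
        using \<Omega>s by (simp add: integral_restrict_space)
      finally show "(LINT x|lebesgue_on \<Omega>. q x * \<phi> x) =
        (LINT x|lebesgue_on \<Omega>. v x $ 2 * partial_deriv 1 \<phi> x - v x $ 1 * partial_deriv 2 \<phi> x)" by simp
    qed
    moreover have "L2_norm \<Omega> v \<le> D * L2_norm \<Omega> q"
    proof -
      have "(L2_norm \<Omega> v)\<^sup>2 = (LINT x|lebesgue_on \<Omega>. (F x)\<^sup>2)"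
        by (simp add: L2_norm_def L2_inner_def v_def power2_eq_square axis_def inner_vec_def sum_2)
      also have "\<dots> = (LINT x|lebesgue. indicator \<Omega> x *\<^sub>R (F x)\<^sup>2)"
        using \<Omega>s by (simp add: integral_restrict_space)
      also have "\<dots> \<le> (LINT x|lebesgue. (F x)\<^sup>2)"
      proof (rule integral_mono)
        show "integrable lebesgue (\<lambda>x. (F x)\<^sup>2)" using L2_D(2)[OF FL] by simp
        from integrable_mult_indicator[OF \<Omega>s this]
        show "integrable lebesgue (\<lambda>x. indicator \<Omega> x *\<^sub>R (F x)\<^sup>2)" .
      qed (simp add: indicator_def)
      also have "\<dots> = (LINT x|lborel. (F x)\<^sup>2)" by (rule integral_completion) measurable
      also have "\<dots> \<le> (D * L2_norm \<Omega> q)\<^sup>2"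
        using Fint F2 by (simp add: nn_integral_eq_integral)
      finally show ?thesis
        by (rule power2_le_imp_le) (use D in \<open>simp add: L2_norm_def L2_inner_def\<close>)
    qed
    ultimately show "\<exists>v\<in>L2 \<Omega>. has_weak_curl \<Omega> v q \<and> L2_norm \<Omega> v \<le> D * L2_norm \<Omega> q"
      using vL by blast
  qed (rule D)
qed


section \<open>Weak curl, its adjoint and the mixed problem\<close>

lemma L2_norm_nonneg: "0 \<le> L2_norm \<Omega> f"
  by (simp add: L2_norm_def L2_inner_def)

lemma L2_norm_power2: "(L2_norm \<Omega> f)\<^sup>2 = L2_inner \<Omega> f f"
  by (simp add: L2_norm_def L2_inner_def)

lemma L2_inner_commute: "L2_inner \<Omega> f g = L2_inner \<Omega> g f"
  by (simp add: L2_inner_def inner_commute)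

lemma L2_inner_diff_left:
  "f \<in> L2 \<Omega> \<Longrightarrow> g \<in> L2 \<Omega> \<Longrightarrow> h \<in> L2 \<Omega> \<Longrightarrow> L2_inner \<Omega> (\<lambda>x. f x - g x) h = L2_inner \<Omega> f h - L2_inner \<Omega> g h"
  by (simp add: L2_inner_def inner_diff_left L2_inner_integrable)

lemma L2_inner_diff_right:
  "f \<in> L2 \<Omega> \<Longrightarrow> g \<in> L2 \<Omega> \<Longrightarrow> h \<in> L2 \<Omega> \<Longrightarrow> L2_inner \<Omega> h (\<lambda>x. f x - g x) = L2_inner \<Omega> h f - L2_inner \<Omega> h g"
  using L2_inner_diff_left[of f \<Omega> g h] by (simp add: L2_inner_commute)

lemma L2_inner_mono:
  assumes "f \<in> L2 \<Omega>" "g \<in> L2 \<Omega>" "f' \<in> L2 \<Omega>" "g' \<in> L2 \<Omega>" "AE x in lebesgue_on \<Omega>. f x \<bullet> g x \<le> f' x \<bullet> g' x"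
  shows "L2_inner \<Omega> f g \<le> L2_inner \<Omega> f' g'"
  unfolding L2_inner_def using assms by (intro integral_mono_AE L2_inner_integrable)

lemma L2_norm_mono:
  assumes "f \<in> L2 \<Omega>" "g \<in> L2 \<Omega>" "c \<ge> 0" "AE x in lebesgue_on \<Omega>. norm (f x) \<le> c * norm (g x)"
  shows "L2_norm \<Omega> f \<le> c * L2_norm \<Omega> g"
proof (rule power2_le_imp_le)
  have "L2_inner \<Omega> f f \<le> L2_inner \<Omega> (\<lambda>x. c *\<^sub>R g x) (\<lambda>x. c *\<^sub>R g x)"
  proof (intro L2_inner_mono assms L2_scaleR)
    show "AE x in lebesgue_on \<Omega>. f x \<bullet> f x \<le> (c *\<^sub>R g x) \<bullet> (c *\<^sub>R g x)"
      using assms(4)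
    proof eventually_elim
      fix x assume "norm (f x) \<le> c * norm (g x)"
      then have "(norm (f x))\<^sup>2 \<le> (c * norm (g x))\<^sup>2" by (intro power_mono) auto
      then show "f x \<bullet> f x \<le> (c *\<^sub>R g x) \<bullet> (c *\<^sub>R g x)"
        by (simp add: power_mult_distrib power2_norm_eq_inner) (simp add: power2_eq_square mult.assoc)
    qed
  qed
  also have "\<dots> = c\<^sup>2 * L2_inner \<Omega> g g" by (simp add: L2_inner_def power2_eq_square mult.assoc)
  finally show "(L2_norm \<Omega> f)\<^sup>2 \<le> (c * L2_norm \<Omega> g)\<^sup>2"
    by (simp add: L2_norm_power2 power_mult_distrib)
  show "0 \<le> c * L2_norm \<Omega> g" using assms(3) by (simp add: L2_norm_nonneg)
qed

lemma L2_norm_cong_AE: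
  assumes "f \<in> L2 \<Omega>" "g \<in> L2 \<Omega>" "AE x in lebesgue_on \<Omega>. f x = g x"
  shows "L2_norm \<Omega> f = L2_norm \<Omega> g"
  unfolding L2_norm_def using L2_inner_cong_AE[OF assms(1,2,1,2,3,3)] by simp

lemma L2_Pair:
  assumes "h \<in> L2 \<Omega>" "a \<in> L2 \<Omega>"
  shows "(\<lambda>x. (h x, a x)) \<in> L2 \<Omega>"
proof (rule L2_I)
  note [measurable] = assms[THEN L2_D(1)]
  show "(\<lambda>x. (h x, a x)) \<in> borel_measurable (lebesgue_on \<Omega>)" by measurable
  show "integrable (lebesgue_on \<Omega>) (\<lambda>x. (norm (h x, a x))\<^sup>2)"
    using assms[THEN L2_D(2)] by (simp add: norm_Pair)
qed

lemma L2_fst: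
  assumes "f \<in> L2 \<Omega>" shows "(\<lambda>x. fst (f x)) \<in> L2 \<Omega>"
proof (rule L2_bound[OF _ assms])
  show "(\<lambda>x. fst (f x)) \<in> borel_measurable (lebesgue_on \<Omega>)"
    by (rule measurable_compose[OF L2_D(1)[OF assms]]) (intro borel_measurable_continuous_onI continuous_intros)
  show "AE x in lebesgue_on \<Omega>. norm (fst (f x)) \<le> 1 * norm (f x)"
    by (rule AE_I2) (metis mult_1 norm_fst_le prod.collapse)
qed

lemma L2_snd:
  assumes "f \<in> L2 \<Omega>" shows "(\<lambda>x. snd (f x)) \<in> L2 \<Omega>"
proof (rule L2_bound[OF _ assms])
  show "(\<lambda>x. snd (f x)) \<in> borel_measurable (lebesgue_on \<Omega>)"
    by (rule measurable_compose[OF L2_D(1)[OF assms]]) (intro borel_measurable_continuous_onI continuous_intros)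
  show "AE x in lebesgue_on \<Omega>. norm (snd (f x)) \<le> 1 * norm (f x)"
    by (rule AE_I2) (metis mult_1 norm_snd_le prod.collapse)
qed

lemma L2_inner_Pair:
  assumes "h \<in> L2 \<Omega>" "a \<in> L2 \<Omega>" "k \<in> L2 \<Omega>" "b \<in> L2 \<Omega>"
  shows "L2_inner \<Omega> (\<lambda>x. (h x, a x)) (\<lambda>x. (k x, b x)) = L2_inner \<Omega> h k + L2_inner \<Omega> a b"
  using assms by (simp add: L2_inner_def L2_inner_integrable)

text \<open>
  The infimum defining the norm is attained: intersect the almost-everywhere bounds with
  constants \<open>Linf_norm \<Omega> \<sigma> + 1/n\<close>.
\<close>

lemma Linf_norm_bound:
  assumes "\<sigma> \<in> Linf \<Omega>"
  shows "0 \<le> Linf_norm \<Omega> \<sigma>" "AE x in lebesgue_on \<Omega>. \<bar>\<sigma> x\<bar> \<le> Linf_norm \<Omega> \<sigma>"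
proof -
  let ?S = "{M. 0 \<le> M \<and> (AE x in lebesgue_on \<Omega>. \<bar>\<sigma> x\<bar> \<le> M)}"
  obtain M where "AE x in lebesgue_on \<Omega>. \<bar>\<sigma> x\<bar> \<le> M" using assms by (auto simp: Linf_def)
  then have "AE x in lebesgue_on \<Omega>. \<bar>\<sigma> x\<bar> \<le> max 0 M" by eventually_elim simp
  then have "max 0 M \<in> ?S" by simp
  then have ne: "?S \<noteq> {}" by blast
  show "0 \<le> Linf_norm \<Omega> \<sigma>" unfolding Linf_norm_def using ne by (intro cInf_greatest) auto
  have "AE x in lebesgue_on \<Omega>. \<bar>\<sigma> x\<bar> \<le> Linf_norm \<Omega> \<sigma> + inverse (real (Suc n))" for n
  proof -
    have "Inf ?S < Linf_norm \<Omega> \<sigma> + inverse (real (Suc n))" by (simp add: Linf_norm_def)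
    from cInf_lessD[OF ne this] obtain M where "AE x in lebesgue_on \<Omega>. \<bar>\<sigma> x\<bar> \<le> M"
      "M < Linf_norm \<Omega> \<sigma> + inverse (real (Suc n))" by auto
    then show ?thesis by (auto elim!: eventually_mono)
  qed
  then have "AE x in lebesgue_on \<Omega>. \<forall>n. \<bar>\<sigma> x\<bar> \<le> Linf_norm \<Omega> \<sigma> + inverse (real (Suc n))"
    by (simp add: AE_all_countable)
  then show "AE x in lebesgue_on \<Omega>. \<bar>\<sigma> x\<bar> \<le> Linf_norm \<Omega> \<sigma>"
  proof eventually_elim
    fix x assume *: "\<forall>n. \<bar>\<sigma> x\<bar> \<le> Linf_norm \<Omega> \<sigma> + inverse (real (Suc n))"
    show "\<bar>\<sigma> x\<bar> \<le> Linf_norm \<Omega> \<sigma>"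
    proof (rule field_le_epsilon)
      fix e :: real assume "e > 0"
      then obtain n where "inverse (real (Suc n)) < e" using reals_Archimedean by blast
      then show "\<bar>\<sigma> x\<bar> \<le> Linf_norm \<Omega> \<sigma> + e" using *[rule_format, of n] by linarith
    qed
  qed
qed

lemma L2_Linf_mult:
  assumes "\<sigma> \<in> Linf \<Omega>" "a \<in> L2 \<Omega>"
  shows "(\<lambda>x. \<sigma> x * a x) \<in> L2 \<Omega>"
proof (rule L2_bound)
  show "(\<lambda>x. \<sigma> x * a x) \<in> borel_measurable (lebesgue_on \<Omega>)"
    using assms by (intro borel_measurable_times) (auto simp: Linf_def L2_def)
  show "AE x in lebesgue_on \<Omega>. norm (\<sigma> x * a x) \<le> Linf_norm \<Omega> \<sigma> * norm (a x)"
    using Linf_norm_bound(2)[OF assms(1)] by eventually_elim (auto simp: abs_mult mult_right_mono)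
qed fact

text \<open>
  The formal adjoint of the curl; the sign convention is that of \<open>has_weak_curl\<close>, which thereby
  becomes a statement on inner products.
\<close>

definition perp_grad :: "(real^2 \<Rightarrow> real) \<Rightarrow> real^2 \<Rightarrow> real^2" where
  "perp_grad \<phi> x = (- partial_deriv 2 \<phi> x) *\<^sub>R axis 1 1 + partial_deriv 1 \<phi> x *\<^sub>R axis 2 1"

lemma has_weak_curl_iff:
  "has_weak_curl \<Omega> v w \<longleftrightarrow> (\<forall>\<phi>. test_function \<Omega> \<phi> \<longrightarrow> L2_inner \<Omega> w \<phi> = L2_inner \<Omega> v (perp_grad \<phi>))"
proof -
  have "v x $ 2 * partial_deriv 1 \<phi> x - v x $ 1 * partial_deriv 2 \<phi> x = v x \<bullet> perp_grad \<phi> x" for v x \<phi>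
    by (simp add: perp_grad_def inner_vec_def sum_2 axis_def)
  then show ?thesis by (simp add: has_weak_curl_def L2_inner_def)
qed

text \<open>
  The graph of the Hilbert space adjoint of the unbounded operator curl: \<open>a\<close> is in its domain
  and is mapped to \<open>h\<close>. In classical terms, \<open>a\<close> vanishes on the boundary in the sense of
  \<open>H\<^sub>0\<^sup>1\<close> and \<open>h\<close> is its weak perpendicular gradient.
\<close>

definition curl_adjoint :: "(real^2) set \<Rightarrow> (real^2 \<Rightarrow> real^2) \<Rightarrow> (real^2 \<Rightarrow> real) \<Rightarrow> bool" where
  "curl_adjoint \<Omega> h a \<longleftrightarrow> h \<in> L2 \<Omega> \<and> a \<in> L2 \<Omega> \<and>
    (\<forall>v\<in>L2 \<Omega>. \<forall>w\<in>L2 \<Omega>. has_weak_curl \<Omega> v w \<longrightarrow> L2_inner \<Omega> h v = L2_inner \<Omega> a w)"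

lemma curl_adjoint_diff:
  assumes "curl_adjoint \<Omega> h a" "curl_adjoint \<Omega> h' a'"
  shows "curl_adjoint \<Omega> (\<lambda>x. h x - h' x) (\<lambda>x. a x - a' x)"
  using assms by (auto simp: curl_adjoint_def L2_diff L2_inner_diff_left)

context
  fixes \<Omega> :: "(real^2) set"
  assumes op: "open \<Omega>" and bd: "bounded \<Omega>"
begin

lemma domain_lmeasurable: "\<Omega> \<in> lmeasurable" using op bd by (simp add: lmeasurable_open)

lemma domain_sets: "\<Omega> \<in> sets lebesgue" using op by simp

lemma L2_Cauchy_Schwarz:
  assumes "f \<in> L2 \<Omega>" "g \<in> L2 \<Omega>"
  shows "\<bar>L2_inner \<Omega> f g\<bar> \<le> L2_norm \<Omega> f * L2_norm \<Omega> g"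
  using Cauchy_Schwarz_ineq2[of "ext_l2 \<Omega> f" "ext_l2 \<Omega> g"] assms
  by (simp add: inner_ext_l2 norm_ext_l2 domain_sets)

lemma L2_norm_triangle:
  assumes "f \<in> L2 \<Omega>" "g \<in> L2 \<Omega>"
  shows "L2_norm \<Omega> (\<lambda>x. f x + g x) \<le> L2_norm \<Omega> f + L2_norm \<Omega> g"
  using norm_triangle_ineq[of "ext_l2 \<Omega> f" "ext_l2 \<Omega> g"] assms
  by (simp add: norm_ext_l2 domain_sets L2_add flip: ext_l2_add)

lemma L2_norm_triangle_diff:
  assumes "f \<in> L2 \<Omega>" "g \<in> L2 \<Omega>"
  shows "L2_norm \<Omega> (\<lambda>x. f x - g x) \<le> L2_norm \<Omega> f + L2_norm \<Omega> g"
  using norm_triangle_ineq4[of "ext_l2 \<Omega> f" "ext_l2 \<Omega> g"] assms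
  by (simp add: norm_ext_l2 domain_sets L2_diff flip: ext_l2_diff)

lemma L2_diff_norm_zeroD:
  assumes "f \<in> L2 \<Omega>" "g \<in> L2 \<Omega>" "L2_norm \<Omega> (\<lambda>x. f x - g x) = 0"
  shows "AE x in lebesgue_on \<Omega>. f x = g x"
proof -
  have "norm (ext_l2 \<Omega> f - ext_l2 \<Omega> g) = 0"
    using assms by (simp add: norm_ext_l2 domain_sets L2_diff flip: ext_l2_diff)
  then show ?thesis using assms by (simp add: ext_l2_eq_iff domain_sets)
qed

lemma L2_const: "(\<lambda>x. c::'b::euclidean_space) \<in> L2 \<Omega>"
  by (rule L2_bounded_on_finite[OF domain_lmeasurable, of _ "norm c"]) auto

lemma L2_norm_const: "L2_norm \<Omega> (\<lambda>x. c::'b::euclidean_space) = sqrt (measure lebesgue \<Omega>) * norm c"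
proof -
  have "L2_inner \<Omega> (\<lambda>x. c) (\<lambda>x. c) = measure lebesgue \<Omega> * (norm c)\<^sup>2"
    by (simp add: L2_inner_def power2_norm_eq_inner measure_restrict_space domain_sets)
  then show ?thesis by (simp add: L2_norm_def real_sqrt_mult)
qed

lemma L2_Lipschitz_compose:
  fixes f :: "'a::euclidean_space \<Rightarrow> 'b::euclidean_space"
  assumes lip: "\<And>y z. norm (f y - f z) \<le> L * norm (y - z)" and h: "h \<in> L2 \<Omega>"
  shows "(\<lambda>x. f (h x)) \<in> L2 \<Omega>"
proof -
  have "\<bar>L\<bar>-lipschitz_on UNIV f"
  proof (rule lipschitz_onI)
    fix y z
    have "dist (f y) (f z) \<le> L * dist y z" using lip by (simp add: dist_norm)
    also have "\<dots> \<le> \<bar>L\<bar> * dist y z" by (intro mult_right_mono) auto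
    finally show "dist (f y) (f z) \<le> \<bar>L\<bar> * dist y z" .
  qed simp
  then have "continuous_on UNIV f" by (rule lipschitz_on_continuous_on)
  then have fm: "f \<in> borel_measurable borel" by (rule borel_measurable_continuous_onI)
  have m: "(\<lambda>x. f (h x)) \<in> borel_measurable (lebesgue_on \<Omega>)"
    by (rule measurable_compose[OF L2_D(1)[OF h] fm])
  have "(\<lambda>x. f (h x) - f 0) \<in> L2 \<Omega>"
  proof (rule L2_bound[OF _ h])
    show "(\<lambda>x. f (h x) - f 0) \<in> borel_measurable (lebesgue_on \<Omega>)" using m by simp
    show "AE x in lebesgue_on \<Omega>. norm (f (h x) - f 0) \<le> L * norm (h x)"
      using lip[of _ 0] by simp
  qed
  from L2_add[OF this L2_const[of "f 0"]] show ?thesis by simp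
qed

lemma perp_grad_L2: "test_function \<Omega> \<phi> \<Longrightarrow> perp_grad \<phi> \<in> L2 \<Omega>"
  unfolding perp_grad_def
proof (rule L2_add)
  assume \<phi>: "test_function \<Omega> \<phi>"
  have "(\<lambda>x. \<psi> x *\<^sub>R axis i (1::real)) \<in> L2 \<Omega>" if "\<psi> \<in> L2 \<Omega>" for \<psi> and i :: 2
  proof (rule L2_bound[OF _ that])
    show "(\<lambda>x. \<psi> x *\<^sub>R axis i (1::real)) \<in> borel_measurable (lebesgue_on \<Omega>)"
      using L2_D(1)[OF that] by (intro borel_measurable_scaleR) auto
    show "AE x in lebesgue_on \<Omega>. norm (\<psi> x *\<^sub>R axis i (1::real)) \<le> 1 * norm (\<psi> x)" by simp
  qed
  note scale = this
  show "(\<lambda>x. (- partial_deriv 2 \<phi> x) *\<^sub>R axis 1 1 :: real^2) \<in> L2 \<Omega>"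
    by (intro scale L2_uminus test_function_in_L2(2)[OF domain_sets \<phi>])
  show "(\<lambda>x. partial_deriv 1 \<phi> x *\<^sub>R axis 2 1 :: real^2) \<in> L2 \<Omega>"
    by (intro scale test_function_in_L2(2)[OF domain_sets \<phi>])
qed

lemma curl_adjoint_test_function:
  assumes "test_function \<Omega> \<phi>" shows "curl_adjoint \<Omega> (perp_grad \<phi>) \<phi>"
  using assms test_function_in_L2[OF domain_sets assms] perp_grad_L2[OF assms]
  by (auto simp: curl_adjoint_def has_weak_curl_iff L2_inner_commute)

lemma has_weak_curl_diff:
  assumes "has_weak_curl \<Omega> v w" "has_weak_curl \<Omega> v' w'" "v \<in> L2 \<Omega>" "w \<in> L2 \<Omega>" "v' \<in> L2 \<Omega>" "w' \<in> L2 \<Omega>"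
  shows "has_weak_curl \<Omega> (\<lambda>x. v x - v' x) (\<lambda>x. w x - w' x)"
  using assms by (auto simp: has_weak_curl_iff L2_inner_diff_left test_function_in_L2 domain_sets perp_grad_L2)

lemma has_weak_curl_cong_AE:
  assumes "has_weak_curl \<Omega> v w" "w \<in> L2 \<Omega>" "w' \<in> L2 \<Omega>" "AE x in lebesgue_on \<Omega>. w x = w' x"
  shows "has_weak_curl \<Omega> v w'"
  unfolding has_weak_curl_iff
proof (intro allI impI)
  fix \<phi> assume \<phi>: "test_function \<Omega> \<phi>"
  have "L2_inner \<Omega> w \<phi> = L2_inner \<Omega> w' \<phi>"
    by (rule L2_inner_cong_AE) (use assms test_function_in_L2[OF domain_sets \<phi>] in auto)
  then show "L2_inner \<Omega> w' \<phi> = L2_inner \<Omega> v (perp_grad \<phi>)"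
    using assms(1) \<phi> by (simp add: has_weak_curl_iff)
qed

text \<open>
  Makes the choice in \<open>curl\<close> harmless: any weak curl in \<open>L2 \<Omega>\<close> agrees with it almost everywhere.
\<close>

lemma weak_curl_unique:
  assumes "has_weak_curl \<Omega> v w" "has_weak_curl \<Omega> v w'" "w \<in> L2 \<Omega>" "w' \<in> L2 \<Omega>"
  shows "AE x in lebesgue_on \<Omega>. w x = w' x"
proof -
  have "AE x in lebesgue_on \<Omega>. w x - w' x = 0"
  proof (rule fundamental_lemma_calculus_of_variations[OF op bd L2_diff[OF assms(3,4)]])
    fix \<phi> assume \<phi>: "test_function \<Omega> \<phi>"
    have "L2_inner \<Omega> (\<lambda>x. w x - w' x) \<phi> = 0"
      using assms \<phi> test_function_in_L2[OF domain_sets \<phi>]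
      by (simp add: L2_inner_diff_left has_weak_curl_iff)
    then show "(LINT x|lebesgue_on \<Omega>. (w x - w' x) * \<phi> x) = 0" by (simp add: L2_inner_def)
  qed
  then show ?thesis by simp
qed

lemma HcurlD:
  assumes "v \<in> Hcurl \<Omega>"
  shows "v \<in> L2 \<Omega>" "curl \<Omega> v \<in> L2 \<Omega>" "has_weak_curl \<Omega> v (curl \<Omega> v)"
proof -
  have "\<exists>w. w \<in> L2 \<Omega> \<and> has_weak_curl \<Omega> v w" using assms by (auto simp: Hcurl_def)
  from someI_ex[OF this] show "curl \<Omega> v \<in> L2 \<Omega>" "has_weak_curl \<Omega> v (curl \<Omega> v)"
    by (auto simp: curl_def)
  show "v \<in> L2 \<Omega>" using assms by (simp add: Hcurl_def)
qed

lemma curl_AE_eq: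
  assumes "v \<in> L2 \<Omega>" "w \<in> L2 \<Omega>" "has_weak_curl \<Omega> v w"
  shows "v \<in> Hcurl \<Omega>" "AE x in lebesgue_on \<Omega>. curl \<Omega> v x = w x"
proof -
  show "v \<in> Hcurl \<Omega>" using assms by (auto simp: Hcurl_def)
  from HcurlD[OF this] show "AE x in lebesgue_on \<Omega>. curl \<Omega> v x = w x"
    using weak_curl_unique assms by blast
qed

text \<open>
  The form in which the mixed problem is treated from here on: the second equation, tested with
  all of \<open>L2 \<Omega>\<close>, says that \<open>j - \<sigma> a\<close> is a weak curl of \<open>H\<close>, and the first says that \<open>a\<close> lies in the domain
  of the adjoint of curl with image \<open>g' (H)\<close>.
\<close>

lemma mixed_solution_iff:
  assumes \<sigma>: "\<sigma> \<in> Linf \<Omega>" and j: "j \<in> L2 \<Omega>"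
    and lip: "\<And>y z. norm (g' y - g' z) \<le> L * norm (y - z)"
  shows "mixed_solution \<Omega> \<sigma> g' j H a \<longleftrightarrow>
    H \<in> L2 \<Omega> \<and> has_weak_curl \<Omega> H (\<lambda>x. j x - \<sigma> x * a x) \<and> curl_adjoint \<Omega> (\<lambda>x. g' (H x)) a"
    (is "?l \<longleftrightarrow> ?r")
proof
  assume sol: ?l
  then have HC: "H \<in> Hcurl \<Omega>" and aL: "a \<in> L2 \<Omega>"
    and e1: "\<And>v. v \<in> Hcurl \<Omega> \<Longrightarrow> L2_inner \<Omega> (\<lambda>x. g' (H x)) v - L2_inner \<Omega> a (curl \<Omega> v) = 0"
    and e2: "\<And>q. q \<in> L2 \<Omega> \<Longrightarrow> L2_inner \<Omega> (curl \<Omega> H) q + L2_inner \<Omega> (\<lambda>x. \<sigma> x * a x) q = L2_inner \<Omega> j q"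
    by (auto simp: mixed_solution_def)
  note H = HcurlD[OF HC]
  have sa: "(\<lambda>x. \<sigma> x * a x) \<in> L2 \<Omega>" by (rule L2_Linf_mult[OF \<sigma> aL])
  have res: "(\<lambda>x. j x - \<sigma> x * a x) \<in> L2 \<Omega>" by (rule L2_diff[OF j sa])
  let ?q = "\<lambda>x. curl \<Omega> H x - (j x - \<sigma> x * a x)"
  have q: "?q \<in> L2 \<Omega>" by (rule L2_diff[OF H(2) res])
  have "L2_inner \<Omega> ?q ?q = 0"
    using e2[OF q] by (simp add: L2_inner_diff_left H(2) res q j sa)
  then have "AE x in lebesgue_on \<Omega>. curl \<Omega> H x = j x - \<sigma> x * a x"
    using L2_diff_norm_zeroD[OF H(2) res] by (simp add: L2_norm_def)
  then have "has_weak_curl \<Omega> H (\<lambda>x. j x - \<sigma> x * a x)"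
    using has_weak_curl_cong_AE[OF H(3,2) res] by blast
  moreover have "curl_adjoint \<Omega> (\<lambda>x. g' (H x)) a"
    unfolding curl_adjoint_def
  proof (intro conjI ballI impI)
    show "(\<lambda>x. g' (H x)) \<in> L2 \<Omega>" by (rule L2_Lipschitz_compose[OF lip H(1)])
    fix v :: "real^2 \<Rightarrow> real^2" and w :: "real^2 \<Rightarrow> real"
    assume vw: "v \<in> L2 \<Omega>" "w \<in> L2 \<Omega>" "has_weak_curl \<Omega> v w"
    have "L2_inner \<Omega> a (curl \<Omega> v) = L2_inner \<Omega> a w"
      by (rule L2_inner_cong_AE) (use aL vw curl_AE_eq[OF vw] HcurlD in auto)
    then show "L2_inner \<Omega> (\<lambda>x. g' (H x)) v = L2_inner \<Omega> a w"
      using e1[OF curl_AE_eq(1)[OF vw]] by simp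
  qed (rule aL)
  ultimately show ?r using H(1) by simp
next
  assume r: ?r
  then have H: "H \<in> L2 \<Omega>" and wc: "has_weak_curl \<Omega> H (\<lambda>x. j x - \<sigma> x * a x)"
    and adj: "curl_adjoint \<Omega> (\<lambda>x. g' (H x)) a" by auto
  have aL: "a \<in> L2 \<Omega>" using adj by (simp add: curl_adjoint_def)
  have sa: "(\<lambda>x. \<sigma> x * a x) \<in> L2 \<Omega>" by (rule L2_Linf_mult[OF \<sigma> aL])
  have res: "(\<lambda>x. j x - \<sigma> x * a x) \<in> L2 \<Omega>" by (rule L2_diff[OF j sa])
  note c = curl_AE_eq[OF H res wc]
  show ?l
    unfolding mixed_solution_def
  proof (intro conjI ballI)
    show "H \<in> Hcurl \<Omega>" "a \<in> L2 \<Omega>" by (rule c, rule aL)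
    show "L2_inner \<Omega> (\<lambda>x. g' (H x)) v - L2_inner \<Omega> a (curl \<Omega> v) = 0" if "v \<in> Hcurl \<Omega>" for v
      using adj HcurlD[OF that] by (auto simp: curl_adjoint_def)
    show "L2_inner \<Omega> (curl \<Omega> H) q + L2_inner \<Omega> (\<lambda>x. \<sigma> x * a x) q = L2_inner \<Omega> j q" if q: "q \<in> L2 \<Omega>" for q
    proof -
      have "L2_inner \<Omega> (curl \<Omega> H) q = L2_inner \<Omega> (\<lambda>x. j x - \<sigma> x * a x) q"
        by (rule L2_inner_cong_AE) (use c HcurlD[OF c(1)] res q in auto)
      then show ?thesis by (simp add: L2_inner_diff_left j sa q)
    qed
  qed
qed

end


section \<open>Existence, uniqueness and estimates\<close>

text \<open>
  Either \<open>x \<le> T\<close>, or \<open>T\<^sup>2\<close> may be replaced by \<open>T x\<close> and the inequality divided by \<open>x\<close>.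
\<close>

lemma quadratic_bound:
  fixes x T b d \<alpha> :: real
  assumes \<alpha>: "0 < \<alpha>" and "0 \<le> x" "0 \<le> T" "0 \<le> b" "0 \<le> d" and le: "\<alpha> * x\<^sup>2 \<le> b * T * x + d * T\<^sup>2"
  shows "x \<le> ((b + d) / \<alpha> + 1) * T"
proof (cases "x \<le> T")
  case True
  also have "T \<le> ((b + d) / \<alpha> + 1) * T"
    using assms \<alpha> by (simp add: distrib_right)
  finally show ?thesis .
next
  case False
  then have x: "x > 0" using assms by linarith
  have "\<alpha> * x * x \<le> b * T * x + d * T * T" using le by (simp add: power2_eq_square mult.assoc)
  also have "\<dots> \<le> b * T * x + d * T * x" using False assms by (intro add_left_mono mult_left_mono) auto
  finally have "(\<alpha> * x) * x \<le> ((b + d) * T) * x" by (simp add: algebra_simps)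
  then have "\<alpha> * x \<le> (b + d) * T" using x by simp
  then have "x \<le> (b + d) / \<alpha> * T" using \<alpha> by (simp add: field_simps)
  then show ?thesis using assms by (simp add: distrib_right)
qed

definition curl_inverse_bound :: "(real^2) set \<Rightarrow> real \<Rightarrow> bool" where
  "curl_inverse_bound \<Omega> c \<longleftrightarrow>
    c > 0 \<and> (\<forall>q\<in>L2 \<Omega>. \<exists>v\<in>L2 \<Omega>. has_weak_curl \<Omega> v q \<and> L2_norm \<Omega> v \<le> c * L2_norm \<Omega> q)"

context
  fixes \<Omega> :: "(real^2) set" and c :: real
  assumes op: "open \<Omega>" and bd: "bounded \<Omega>" and cb: "curl_inverse_bound \<Omega> c"
begin

text \<open>
  The inf-sup condition, in the form of a Poincare inequality: test the adjoint relation with a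
  field \<open>v\<close> whose curl is \<open>a\<close> itself.
\<close>

lemma curl_adjoint_Poincare:
  assumes adj: "curl_adjoint \<Omega> h a"
  shows "L2_norm \<Omega> a \<le> c * L2_norm \<Omega> h"
proof -
  have hL: "h \<in> L2 \<Omega>" and aL: "a \<in> L2 \<Omega>" using adj by (auto simp: curl_adjoint_def)
  obtain v where v: "v \<in> L2 \<Omega>" "has_weak_curl \<Omega> v a" "L2_norm \<Omega> v \<le> c * L2_norm \<Omega> a"
    using cb aL unfolding curl_inverse_bound_def by blast
  have "(L2_norm \<Omega> a)\<^sup>2 = L2_inner \<Omega> h v"
    using adj v aL by (simp add: curl_adjoint_def L2_norm_power2)
  also have "\<dots> \<le> L2_norm \<Omega> h * L2_norm \<Omega> v"
    using L2_Cauchy_Schwarz[OF op bd hL v(1)] by linarith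
  also have "\<dots> \<le> L2_norm \<Omega> h * (c * L2_norm \<Omega> a)"
    by (intro mult_left_mono v L2_norm_nonneg)
  finally have "L2_norm \<Omega> a * L2_norm \<Omega> a \<le> (c * L2_norm \<Omega> h) * L2_norm \<Omega> a"
    by (simp add: power2_eq_square mult_ac)
  moreover have "0 \<le> c * L2_norm \<Omega> h" using cb by (simp add: curl_inverse_bound_def L2_norm_nonneg)
  ultimately show ?thesis
    using L2_norm_nonneg[of \<Omega> a] by (cases "L2_norm \<Omega> a = 0") auto
qed

text \<open>
  The graph of the adjoint of curl, as a subspace of \<open>L\<^sup>2\<close> of the plane, is the orthogonal complement of
  this set, and therefore closed. The first part encodes the adjoint relation, the second the
  vanishing outside \<open>\<Omega>\<close>.
\<close>

definition constraint_set :: "((real^2) \<times> real) l2 set" where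
  "constraint_set = {ext_l2 \<Omega> (\<lambda>x. (v x, - w x)) | v w. v \<in> L2 \<Omega> \<and> w \<in> L2 \<Omega> \<and> has_weak_curl \<Omega> v w}
     \<union> {cls_l2 u | u. u \<in> L2 UNIV \<and> (\<forall>x\<in>\<Omega>. u x = 0)}"

lemma constraint_complement_iff:
  assumes h: "h \<in> L2 \<Omega>" and a: "a \<in> L2 \<Omega>"
  shows "ext_l2 \<Omega> (\<lambda>x. (h x, a x)) \<in> constraint_set\<^sup>\<bottom> \<longleftrightarrow> curl_adjoint \<Omega> h a"
proof -
  note os = domain_sets[OF op bd]
  have ha: "(\<lambda>x. (h x, a x)) \<in> L2 \<Omega>" by (rule L2_Pair[OF h a])
  have 1: "ext_l2 \<Omega> (\<lambda>x. (v x, - w x)) \<bullet> ext_l2 \<Omega> (\<lambda>x. (h x, a x)) = L2_inner \<Omega> h v - L2_inner \<Omega> a w"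
    if "v \<in> L2 \<Omega>" "w \<in> L2 \<Omega>" for v w
  proof -
    have "L2_inner \<Omega> (\<lambda>x. - w x) a = - L2_inner \<Omega> a w"
      by (simp add: L2_inner_def mult.commute)
    then show ?thesis
      using that h a os
      by (simp add: inner_ext_l2 L2_Pair L2_uminus L2_inner_Pair L2_inner_commute[of \<Omega> v h])
  qed
  have 2: "cls_l2 u \<bullet> ext_l2 \<Omega> (\<lambda>x. (h x, a x)) = 0" if u: "u \<in> L2 UNIV" "\<forall>x\<in>\<Omega>. u x = 0" for u
  proof -
    have "(\<lambda>x. indicator \<Omega> x *\<^sub>R (h x, a x)) \<in> L2 UNIV" using ext_in_L2_iff[OF os, of "\<lambda>x. (h x, a x)"] ha by simp
    then have "cls_l2 u \<bullet> ext_l2 \<Omega> (\<lambda>x. (h x, a x)) = L2_inner UNIV u (\<lambda>x. indicator \<Omega> x *\<^sub>R (h x, a x))"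
      unfolding ext_l2_def by (rule inner_cls_l2[OF u(1)])
    also have "\<dots> = L2_inner UNIV u (\<lambda>x. 0)"
      unfolding L2_inner_def
      by (intro Bochner_Integration.integral_cong refl) (use u(2) in \<open>simp add: indicator_def flip: zero_prod_def\<close>)
    finally show ?thesis by (simp add: L2_inner_def)
  qed
  have "ext_l2 \<Omega> (\<lambda>x. (h x, a x)) \<in> constraint_set\<^sup>\<bottom> \<longleftrightarrow>
      (\<forall>v w. v \<in> L2 \<Omega> \<and> w \<in> L2 \<Omega> \<and> has_weak_curl \<Omega> v w \<longrightarrow>
        ext_l2 \<Omega> (\<lambda>x. (v x, - w x)) \<bullet> ext_l2 \<Omega> (\<lambda>x. (h x, a x)) = 0)"
    using 2 unfolding orthogonal_comp_def orthogonal_def constraint_set_def by blast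
  also have "\<dots> \<longleftrightarrow> curl_adjoint \<Omega> h a"
    using h a by (auto simp: curl_adjoint_def 1)
  finally show ?thesis .
qed

text \<open>
  To see that \<open>p\<close> vanishes outside \<open>\<Omega>\<close>, test it with its own restriction to the complement of
  \<open>\<Omega>\<close>.
\<close>

lemma constraint_complement_representation:
  assumes p: "p \<in> constraint_set\<^sup>\<bottom>"
  defines "h \<equiv> (\<lambda>x. fst (rep_l2 p x))" and "a \<equiv> (\<lambda>x. snd (rep_l2 p x))"
  shows "p = ext_l2 \<Omega> (\<lambda>x. (h x, a x))" "curl_adjoint \<Omega> h a"
proof -
  note os = domain_sets[OF op bd]
  define r where "r = rep_l2 p"
  have r: "r \<in> L2 UNIV" "p = cls_l2 r" by (auto simp: r_def rep_l2_in_L2)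
  have rm: "r \<in> borel_measurable lebesgue" using L2_D(1)[OF r(1)] by simp
  have im: "(\<lambda>x. indicator \<Omega> x *\<^sub>R r x) \<in> L2 UNIV"
  proof (rule L2_bound[OF _ r(1)])
    show "(\<lambda>x. indicator \<Omega> x *\<^sub>R r x) \<in> borel_measurable (lebesgue_on UNIV)"
      using rm os by simp
    show "AE x in lebesgue_on UNIV. norm (indicator \<Omega> x *\<^sub>R r x) \<le> 1 * norm (r x)"
      by (rule AE_I2) (simp add: indicator_def)
  qed
  then have rO: "r \<in> L2 \<Omega>" using ext_in_L2_iff[OF os, of r] by simp
  define u where "u x = r x - indicator \<Omega> x *\<^sub>R r x" for x
  have uL: "u \<in> L2 UNIV" unfolding u_def by (rule L2_diff[OF r(1) im])
  have "cls_l2 u \<in> constraint_set" using uL by (auto simp: constraint_set_def u_def)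
  then have "cls_l2 u \<bullet> p = 0" using p by (simp add: orthogonal_comp_def orthogonal_def)
  moreover have "cls_l2 u \<bullet> p = cls_l2 u \<bullet> cls_l2 u"
  proof -
    have "cls_l2 u \<bullet> p = L2_inner UNIV u r" unfolding r(2) by (rule inner_cls_l2[OF uL r(1)])
    also have "\<dots> = L2_inner UNIV u u"
      unfolding L2_inner_def by (intro Bochner_Integration.integral_cong) (auto simp: u_def indicator_def)
    finally show ?thesis by (simp add: inner_cls_l2[OF uL uL])
  qed
  ultimately have "cls_l2 u = 0" by simp
  moreover have "cls_l2 u = p - ext_l2 \<Omega> r"
    unfolding u_def[abs_def] ext_l2_def r(2) by (rule cls_l2_diff[OF r(1) im])
  ultimately have "p = ext_l2 \<Omega> r" by simp
  then show eq: "p = ext_l2 \<Omega> (\<lambda>x. (h x, a x))" by (simp add: h_def a_def r_def)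
  have "h \<in> L2 \<Omega>" "a \<in> L2 \<Omega>" using L2_fst[OF rO] L2_snd[OF rO] by (auto simp: h_def a_def r_def)
  from constraint_complement_iff[OF this] p eq show "curl_adjoint \<Omega> h a" by simp
qed

text \<open>
  The problem that remains for \<open>(h, a)\<close> when \<open>H = f h\<close> is eliminated: on the graph of the adjoint
  of curl, the map \<open>(h, a) \<mapsto> (f h, \<sigma> a - j)\<close> has to be orthogonal to the graph. The map controls
  only the \<open>h\<close> component of a difference, but on the graph the Poincare inequality bounds
  the \<open>a\<close> component by the \<open>h\<close> component, so it is strongly monotone there.
\<close>

lemma reduced_problem_solvable:
  fixes f :: "real^2 \<Rightarrow> real^2"
  assumes m: "m > 0" and mono: "\<And>y z. m * (norm (y - z))\<^sup>2 \<le> (f y - f z) \<bullet> (y - z)"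
    and lip: "\<And>y z. norm (f y - f z) \<le> L * norm (y - z)"
    and \<sigma>: "\<sigma> \<in> Linf \<Omega>" "AE x in lebesgue_on \<Omega>. \<sigma> x \<ge> 0" and j: "j \<in> L2 \<Omega>"
  shows "\<exists>h a. curl_adjoint \<Omega> h a \<and>
    (\<forall>k b. curl_adjoint \<Omega> k b \<longrightarrow>
      L2_inner \<Omega> (\<lambda>x. f (h x)) k + L2_inner \<Omega> (\<lambda>x. \<sigma> x * a x - j x) b = 0)"
proof -
  note os = domain_sets[OF op bd]
  have c: "c > 0" using cb by (simp add: curl_inverse_bound_def)
  define W where "W = constraint_set\<^sup>\<bottom>"
  define h where "h p x = fst (rep_l2 p x)" for p :: "((real^2) \<times> real) l2" and x
  define a where "a p x = snd (rep_l2 p x)" for p :: "((real^2) \<times> real) l2" and x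
  define B where "B h a x = (f (h x), \<sigma> x * a x - j x)" for h a and x :: "real^2"
  define A where "A p = ext_l2 \<Omega> (B (h p) (a p))" for p
  have BL: "B h a \<in> L2 \<Omega>" if "h \<in> L2 \<Omega>" "a \<in> L2 \<Omega>" for h a
    unfolding B_def[abs_def]
    by (intro L2_Pair L2_diff j L2_Linf_mult \<sigma> that L2_Lipschitz_compose[OF op bd lip])
  have rep: "p = ext_l2 \<Omega> (\<lambda>x. (h p x, a p x))" "curl_adjoint \<Omega> (h p) (a p)" "h p \<in> L2 \<Omega>" "a p \<in> L2 \<Omega>"
    if "p \<in> W" for p
    using constraint_complement_representation[OF that[unfolded W_def]]
    unfolding h_def[abs_def] a_def[abs_def] by (auto simp: curl_adjoint_def)
  have diff: "p - q = ext_l2 \<Omega> (\<lambda>x. (h p x - h q x, a p x - a q x))" if "p \<in> W" "q \<in> W" for p q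
  proof -
    have "p - q = ext_l2 \<Omega> (\<lambda>x. (h p x, a p x)) - ext_l2 \<Omega> (\<lambda>x. (h q x, a q x))"
      using rep(1) that by metis
    also have "\<dots> = ext_l2 \<Omega> (\<lambda>x. (h p x, a p x) - (h q x, a q x))"
      by (rule ext_l2_diff[OF os, symmetric]) (intro L2_Pair rep that)+
    finally show ?thesis by simp
  qed
  have Adiff: "A p - A q = ext_l2 \<Omega> (\<lambda>x. (f (h p x) - f (h q x), \<sigma> x * (a p x - a q x)))" if "p \<in> W" "q \<in> W" for p q
  proof -
    have "A p - A q = ext_l2 \<Omega> (\<lambda>x. B (h p) (a p) x - B (h q) (a q) x)"
      unfolding A_def by (rule ext_l2_diff[OF os, symmetric]) (intro BL rep that)+
    then show ?thesis by (simp add: B_def algebra_simps)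
  qed
  define m' where "m' = m / (1 + c\<^sup>2)"
  have c1: "1 + c\<^sup>2 > 0" by (simp add: add_pos_nonneg)
  have "\<exists>p\<in>W. \<forall>k\<in>W. A p \<bullet> k = 0"
  proof (rule monotone_equation_solvable)
    show "subspace W" unfolding W_def by (rule subspace_orthogonal_comp)
    show "complete W" unfolding W_def by (rule complete_orthogonal_comp)
    show "m' > 0" using m c1 by (simp add: m'_def)
    fix p q assume pq: "p \<in> W" "q \<in> W"
    let ?h = "\<lambda>x. h p x - h q x" and ?a = "\<lambda>x. a p x - a q x"
    let ?f = "\<lambda>x. f (h p x) - f (h q x)" and ?s = "\<lambda>x. \<sigma> x * (a p x - a q x)"
    have hL: "?h \<in> L2 \<Omega>" and aL: "?a \<in> L2 \<Omega>" by (intro L2_diff rep pq)+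
    have fL: "?f \<in> L2 \<Omega>" by (intro L2_diff L2_Lipschitz_compose[OF op bd lip] rep pq)
    have sL: "?s \<in> L2 \<Omega>" by (intro L2_Linf_mult \<sigma> aL)
    have "curl_adjoint \<Omega> ?h ?a" by (intro curl_adjoint_diff rep pq)
    then have "L2_norm \<Omega> ?a \<le> c * L2_norm \<Omega> ?h" by (rule curl_adjoint_Poincare)
    then have Poi: "(L2_norm \<Omega> ?a)\<^sup>2 \<le> c\<^sup>2 * (L2_norm \<Omega> ?h)\<^sup>2"
      using power_mono[OF _ L2_norm_nonneg] by (metis power_mult_distrib)
    have n: "(norm (p - q))\<^sup>2 = (L2_norm \<Omega> ?h)\<^sup>2 + (L2_norm \<Omega> ?a)\<^sup>2"
      unfolding diff[OF pq] power2_norm_eq_inner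
      by (simp add: inner_ext_l2[OF os] L2_Pair L2_inner_Pair hL aL L2_norm_power2)
    have "m' * (norm (p - q))\<^sup>2 \<le> m' * ((1 + c\<^sup>2) * (L2_norm \<Omega> ?h)\<^sup>2)"
      using Poi n \<open>m' > 0\<close> by (intro mult_left_mono) (auto simp: algebra_simps)
    also have "\<dots> = m * (L2_norm \<Omega> ?h)\<^sup>2" using c1 by (simp add: m'_def)
    also have "\<dots> = L2_inner \<Omega> (\<lambda>x. m *\<^sub>R ?h x) ?h" by (simp add: L2_norm_power2) (simp add: L2_inner_def)
    also have "\<dots> \<le> L2_inner \<Omega> ?f ?h"
      using mono by (intro L2_inner_mono L2_scaleR hL fL AE_I2) (simp add: power2_norm_eq_inner)
    also have "\<dots> \<le> L2_inner \<Omega> ?f ?h + L2_inner \<Omega> ?s ?a"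
    proof -
      have "L2_inner \<Omega> (\<lambda>x. 0) ?a \<le> L2_inner \<Omega> ?s ?a"
      proof (intro L2_inner_mono zero_in_L2 sL aL)
        show "AE x in lebesgue_on \<Omega>. 0 \<bullet> ?a x \<le> ?s x \<bullet> ?a x"
          using \<sigma>(2) by eventually_elim (simp add: mult.assoc)
      qed
      then show ?thesis by (simp add: L2_inner_def)
    qed
    also have "\<dots> = (A p - A q) \<bullet> (p - q)"
      unfolding diff[OF pq] Adiff[OF pq]
      by (simp add: inner_ext_l2[OF os] L2_Pair L2_inner_Pair hL aL fL sL)
    finally show "m' * (norm (p - q))\<^sup>2 \<le> (A p - A q) \<bullet> (p - q)" .
    have "L2_norm \<Omega> (\<lambda>x. (?f x, ?s x)) \<le> (\<bar>L\<bar> + Linf_norm \<Omega> \<sigma>) * L2_norm \<Omega> (\<lambda>x. (?h x, ?a x))"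
    proof (intro L2_norm_mono L2_Pair hL aL fL sL)
      show "\<bar>L\<bar> + Linf_norm \<Omega> \<sigma> \<ge> 0" using Linf_norm_bound(1)[OF \<sigma>(1)] by simp
      show "AE x in lebesgue_on \<Omega>. norm (?f x, ?s x) \<le> (\<bar>L\<bar> + Linf_norm \<Omega> \<sigma>) * norm (?h x, ?a x)"
        using Linf_norm_bound(2)[OF \<sigma>(1)]
      proof eventually_elim
        fix x assume s: "\<bar>\<sigma> x\<bar> \<le> Linf_norm \<Omega> \<sigma>"
        have "norm (?f x, ?s x) \<le> norm (?f x) + norm (?s x)" by (rule norm_Pair_le)
        also have "norm (?f x) \<le> \<bar>L\<bar> * norm (?h x, ?a x)"
        proof -
          have "norm (?f x) \<le> L * norm (?h x)" by (rule lip)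
          also have "\<dots> \<le> \<bar>L\<bar> * norm (?h x)" by (intro mult_right_mono) auto
          also have "\<dots> \<le> \<bar>L\<bar> * norm (?h x, ?a x)" by (intro mult_left_mono norm_fst_le) auto
          finally show ?thesis .
        qed
        also have "norm (?s x) \<le> Linf_norm \<Omega> \<sigma> * norm (?h x, ?a x)"
        proof -
          have "norm (?s x) = \<bar>\<sigma> x\<bar> * norm (?a x)" by (simp add: abs_mult)
          also have "\<dots> \<le> Linf_norm \<Omega> \<sigma> * norm (?h x, ?a x)"
            using s by (intro mult_mono norm_snd_le) auto
          finally show ?thesis .
        qed
        finally show "norm (?f x, ?s x) \<le> (\<bar>L\<bar> + Linf_norm \<Omega> \<sigma>) * norm (?h x, ?a x)"
          by (simp add: algebra_simps)
      qed
    qed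
    then show "norm (A p - A q) \<le> (\<bar>L\<bar> + Linf_norm \<Omega> \<sigma>) * norm (p - q)"
      unfolding diff[OF pq] Adiff[OF pq]
      by (simp add: norm_ext_l2[OF os] L2_Pair hL aL fL sL)
  qed
  then obtain p where p: "p \<in> W" "\<And>k. k \<in> W \<Longrightarrow> A p \<bullet> k = 0" by blast
  have "L2_inner \<Omega> (\<lambda>x. f (h p x)) k + L2_inner \<Omega> (\<lambda>x. \<sigma> x * a p x - j x) b = 0"
    if kb: "curl_adjoint \<Omega> k b" for k b
  proof -
    have kL: "k \<in> L2 \<Omega>" and bL: "b \<in> L2 \<Omega>" using kb by (auto simp: curl_adjoint_def)
    have "ext_l2 \<Omega> (\<lambda>x. (k x, b x)) \<in> W"
      unfolding W_def using constraint_complement_iff[OF kL bL] kb by simp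
    from p(2)[OF this] have "L2_inner \<Omega> (B (h p) (a p)) (\<lambda>x. (k x, b x)) = 0"
      by (simp add: A_def inner_ext_l2[OF os] L2_Pair kL bL BL rep p(1))
    then show ?thesis
      unfolding B_def[abs_def]
      by (subst (asm) L2_inner_Pair) (auto intro!: L2_diff j L2_Linf_mult \<sigma> L2_Lipschitz_compose[OF op bd lip] rep p(1) kL bL)
  qed
  then show ?thesis using rep(2)[OF p(1)] by blast
qed

context
  fixes \<alpha> C\<^sub>a :: real and \<sigma> :: "real^2 \<Rightarrow> real" and g' :: "real^2 \<Rightarrow> real^2" and j :: "real^2 \<Rightarrow> real"
  assumes \<alpha>: "\<alpha> > 0" and C\<^sub>a: "C\<^sub>a > 0"
    and \<sigma>: "\<sigma> \<in> Linf \<Omega>" and \<sigma>0: "AE x in lebesgue_on \<Omega>. \<sigma> x \<ge> 0"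
    and mono: "\<And>y z. (g' y - g' z) \<bullet> (y - z) \<ge> \<alpha> * (norm (y - z))\<^sup>2"
    and lip: "\<And>y z. norm (g' y - g' z) \<le> C\<^sub>a * norm (y - z)"
    and j: "j \<in> L2 \<Omega>"
begin

text \<open>
  Each test function \<open>\<phi>\<close> gives the element \<open>(perp_grad \<phi>, \<phi>)\<close> of the graph; the reduced
  problem tested with these elements is the statement that \<open>j - \<sigma> a\<close> is the weak curl of \<open>f h\<close>.
\<close>

lemma mixed_solution_exists: "\<exists>H a. mixed_solution \<Omega> \<sigma> g' j H a"
proof -
  obtain f where f: "\<And>y. g' (f y) = y" "\<And>y z. norm (f y - f z) \<le> (1 / \<alpha>) * norm (y - z)"
    "\<And>y z. (\<alpha> / C\<^sub>a\<^sup>2) * (norm (y - z))\<^sup>2 \<le> (f y - f z) \<bullet> (y - z)"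
    using strongly_monotone_inverse[OF \<alpha> C\<^sub>a mono lip] by metis
  have "\<alpha> / C\<^sub>a\<^sup>2 > 0" using \<alpha> C\<^sub>a by simp
  from reduced_problem_solvable[OF this f(3) f(2) \<sigma> \<sigma>0 j]
  obtain h a where adj: "curl_adjoint \<Omega> h a"
    and eq: "\<And>k b. curl_adjoint \<Omega> k b \<Longrightarrow>
      L2_inner \<Omega> (\<lambda>x. f (h x)) k + L2_inner \<Omega> (\<lambda>x. \<sigma> x * a x - j x) b = 0" by blast
  have hL: "h \<in> L2 \<Omega>" and aL: "a \<in> L2 \<Omega>" using adj by (auto simp: curl_adjoint_def)
  have "has_weak_curl \<Omega> (\<lambda>x. f (h x)) (\<lambda>x. j x - \<sigma> x * a x)"
    unfolding has_weak_curl_iff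
  proof (intro allI impI)
    fix \<phi> assume "test_function \<Omega> \<phi>"
    from eq[OF curl_adjoint_test_function[OF op bd this]]
    have "L2_inner \<Omega> (\<lambda>x. f (h x)) (perp_grad \<phi>) = - L2_inner \<Omega> (\<lambda>x. \<sigma> x * a x - j x) \<phi>" by simp
    also have "\<dots> = L2_inner \<Omega> (\<lambda>x. j x - \<sigma> x * a x) \<phi>"
      unfolding L2_inner_def integral_minus[symmetric]
      by (intro Bochner_Integration.integral_cong refl) (simp add: algebra_simps)
    finally show "L2_inner \<Omega> (\<lambda>x. j x - \<sigma> x * a x) \<phi> = L2_inner \<Omega> (\<lambda>x. f (h x)) (perp_grad \<phi>)" by simp
  qed
  then have "mixed_solution \<Omega> \<sigma> g' j (\<lambda>x. f (h x)) a"
    using mixed_solution_iff[OF op bd \<sigma> j lip, of "\<lambda>x. f (h x)" a] adj f(1)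
      L2_Lipschitz_compose[OF op bd f(2) hL] by simp
  then show ?thesis by blast
qed

text \<open>
  Testing the difference of the adjoint relations with the difference of the fields gives
  \<open>\<alpha> \<parallel>H - H'\<parallel>\<^sup>2 \<le> (a - a', - \<sigma> (a - a')) \<le> 0\<close>. Then \<open>g' (H) - g' (H')\<close> vanishes as well, and the
  Poincare inequality gives \<open>a = a'\<close>.
\<close>

lemma mixed_solution_unique:
  assumes "mixed_solution \<Omega> \<sigma> g' j H a" "mixed_solution \<Omega> \<sigma> g' j H' a'"
  shows "AE x in lebesgue_on \<Omega>. H x = H' x \<and> a x = a' x"
proof -
  note iff = mixed_solution_iff[OF op bd \<sigma> j lip]
  have s: "H \<in> L2 \<Omega>" "has_weak_curl \<Omega> H (\<lambda>x. j x - \<sigma> x * a x)" "curl_adjoint \<Omega> (\<lambda>x. g' (H x)) a"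
    and s': "H' \<in> L2 \<Omega>" "has_weak_curl \<Omega> H' (\<lambda>x. j x - \<sigma> x * a' x)" "curl_adjoint \<Omega> (\<lambda>x. g' (H' x)) a'"
    using assms by (auto simp: iff)
  have aL: "a \<in> L2 \<Omega>" "a' \<in> L2 \<Omega>" using s(3) s'(3) by (auto simp: curl_adjoint_def)
  have gL: "(\<lambda>x. g' (H x)) \<in> L2 \<Omega>" "(\<lambda>x. g' (H' x)) \<in> L2 \<Omega>"
    using s(3) s'(3) by (auto simp: curl_adjoint_def)
  have rL: "(\<lambda>x. j x - \<sigma> x * a x) \<in> L2 \<Omega>" "(\<lambda>x. j x - \<sigma> x * a' x) \<in> L2 \<Omega>"
    by (intro L2_diff j L2_Linf_mult \<sigma> aL)+
  let ?H = "\<lambda>x. H x - H' x" and ?a = "\<lambda>x. a x - a' x" and ?g = "\<lambda>x. g' (H x) - g' (H' x)"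
  let ?w = "\<lambda>x. (j x - \<sigma> x * a x) - (j x - \<sigma> x * a' x)"
  have HL: "?H \<in> L2 \<Omega>" and dL: "?a \<in> L2 \<Omega>" and wL: "?w \<in> L2 \<Omega>" and gdL: "?g \<in> L2 \<Omega>"
    by (intro L2_diff s s' aL rL gL)+
  have adj: "curl_adjoint \<Omega> ?g ?a" by (rule curl_adjoint_diff[OF s(3) s'(3)])
  have wc: "has_weak_curl \<Omega> ?H ?w"
    by (rule has_weak_curl_diff[OF op bd s(2) s'(2) s(1) rL(1) s'(1) rL(2)])
  have "\<alpha> * (L2_norm \<Omega> ?H)\<^sup>2 = L2_inner \<Omega> (\<lambda>x. \<alpha> *\<^sub>R ?H x) ?H"
    by (simp add: L2_norm_power2) (simp add: L2_inner_def)
  also have "\<dots> \<le> L2_inner \<Omega> ?g ?H"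
    using mono by (intro L2_inner_mono L2_scaleR HL gdL AE_I2) (simp add: power2_norm_eq_inner)
  also have "\<dots> = L2_inner \<Omega> ?a ?w" using adj wc HL wL by (simp add: curl_adjoint_def)
  also have "\<dots> \<le> L2_inner \<Omega> ?a (\<lambda>x. 0)"
  proof (intro L2_inner_mono dL wL zero_in_L2)
    show "AE x in lebesgue_on \<Omega>. ?a x \<bullet> ?w x \<le> ?a x \<bullet> 0"
      using \<sigma>0
    proof eventually_elim
      fix x assume "0 \<le> \<sigma> x"
      then have "0 \<le> \<sigma> x * (?a x)\<^sup>2" by simp
      then show "?a x \<bullet> ?w x \<le> ?a x \<bullet> 0" by (simp add: algebra_simps power2_eq_square)
    qed
  qed
  also have "\<dots> = 0" by (simp add: L2_inner_def)
  finally have "(L2_norm \<Omega> ?H)\<^sup>2 \<le> 0" using \<alpha> by (simp add: mult_le_0_iff)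
  then have "L2_norm \<Omega> ?H = 0" by simp
  then have Heq: "AE x in lebesgue_on \<Omega>. H x = H' x"
    by (rule L2_diff_norm_zeroD[OF op bd s(1) s'(1)])
  have "L2_norm \<Omega> ?g \<le> C\<^sub>a * L2_norm \<Omega> ?H"
    using C\<^sub>a by (intro L2_norm_mono gdL HL AE_I2 lip) auto
  then have "L2_norm \<Omega> ?g = 0" using \<open>L2_norm \<Omega> ?H = 0\<close> L2_norm_nonneg[of \<Omega> ?g] by simp
  then have "L2_norm \<Omega> ?a = 0"
    using curl_adjoint_Poincare[OF adj] L2_norm_nonneg[of \<Omega> ?a] by simp
  then have "AE x in lebesgue_on \<Omega>. a x = a' x"
    by (rule L2_diff_norm_zeroD[OF op bd aL])
  with Heq show ?thesis by eventually_elim simp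
qed

text \<open>
  Here \<open>\<mu> \<bar>g' 0\<bar>\<close> is the norm of the constant field \<open>g' 0\<close>. The Poincare inequality bounds \<open>a\<close> in terms
  of \<open>H\<close>, and testing with \<open>H\<close> itself yields a quadratic inequality for the norm of \<open>H\<close>, which also
  controls \<open>(\<sigma> a, a)\<close>. The bound on \<open>curl H = j - \<sigma> a\<close> rests on
  \<open>\<parallel>\<sigma> a\<parallel>\<^sup>2 \<le> \<parallel>\<sigma>\<parallel>\<^sub>\<infinity> (\<sigma> a, a)\<close>, which is where the square root of the norm of \<open>\<sigma>\<close> comes from.
\<close>

lemma mixed_solution_bounds:
  assumes sol: "mixed_solution \<Omega> \<sigma> g' j H a"
  defines "\<mu> \<equiv> sqrt (measure lebesgue \<Omega>)" and "T \<equiv> L2_norm \<Omega> j + norm (g' 0)"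
  defines "b \<equiv> c * C\<^sub>a + \<mu>" and "d \<equiv> c * \<mu>"
  defines "K \<equiv> (b + d) / \<alpha> + 1"
  shows "L2_norm \<Omega> H \<le> K * T"
    and "L2_norm \<Omega> a \<le> c * (C\<^sub>a * K + \<mu>) * T"
    and "L2_norm \<Omega> (curl \<Omega> H) \<le> (1 + sqrt (Linf_norm \<Omega> \<sigma>) * sqrt (b * K + d)) * T"
proof -
  note iff = mixed_solution_iff[OF op bd \<sigma> j lip]
  have HL: "H \<in> L2 \<Omega>" and wc: "has_weak_curl \<Omega> H (\<lambda>x. j x - \<sigma> x * a x)"
    and adj: "curl_adjoint \<Omega> (\<lambda>x. g' (H x)) a" using sol by (auto simp: iff)
  let ?g = "\<lambda>x. g' (H x)" and ?s = "\<lambda>x. \<sigma> x * a x"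
  have aL: "a \<in> L2 \<Omega>" and gL: "?g \<in> L2 \<Omega>" using adj by (auto simp: curl_adjoint_def)
  have sL: "?s \<in> L2 \<Omega>" by (rule L2_Linf_mult[OF \<sigma> aL])
  have rL: "(\<lambda>x. j x - \<sigma> x * a x) \<in> L2 \<Omega>" by (rule L2_diff[OF j sL])
  have c: "c > 0" using cb by (simp add: curl_inverse_bound_def)
  have cL: "(\<lambda>x. g' 0) \<in> L2 \<Omega>" by (rule L2_const[OF op bd])
  have \<mu>: "\<mu> \<ge> 0" by (simp add: \<mu>_def)
  let ?x = "L2_norm \<Omega> H" and ?J = "L2_norm \<Omega> j" and ?\<gamma> = "norm (g' 0)"
  have x: "?x \<ge> 0" and J: "?J \<ge> 0" by (rule L2_norm_nonneg)+
  have T: "T \<ge> 0" "?J \<le> T" "?\<gamma> \<le> T" using J by (auto simp: T_def)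
  have b: "b \<ge> 0" and d: "d \<ge> 0" using c C\<^sub>a \<mu> by (auto simp: b_def d_def)
  have G: "L2_norm \<Omega> (\<lambda>x. g' 0) \<le> \<mu> * T"
    using T \<mu> by (simp add: L2_norm_const[OF op bd] \<mu>_def mult_left_mono)
  have ng: "L2_norm \<Omega> ?g \<le> C\<^sub>a * ?x + \<mu> * T"
  proof -
    have "L2_norm \<Omega> (\<lambda>x. (g' (H x) - g' 0) + g' 0) \<le> L2_norm \<Omega> (\<lambda>x. g' (H x) - g' 0) + L2_norm \<Omega> (\<lambda>x. g' 0)"
      by (intro L2_norm_triangle[OF op bd] L2_diff gL cL)
    moreover have "L2_norm \<Omega> (\<lambda>x. g' (H x) - g' 0) \<le> C\<^sub>a * ?x"
      using C\<^sub>a lip[of _ 0] by (intro L2_norm_mono L2_diff gL cL HL AE_I2) auto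
    ultimately show ?thesis using G by simp
  qed
  have na: "L2_norm \<Omega> a \<le> c * (C\<^sub>a * ?x + \<mu> * T)"
    using curl_adjoint_Poincare[OF adj] ng c by (meson mult_left_mono order_less_imp_le order_trans)
  have s0: "0 \<le> L2_inner \<Omega> a ?s"
  proof -
    have "L2_inner \<Omega> a (\<lambda>x. 0) \<le> L2_inner \<Omega> a ?s"
    proof (intro L2_inner_mono aL sL zero_in_L2)
      show "AE x in lebesgue_on \<Omega>. a x \<bullet> 0 \<le> a x \<bullet> ?s x"
        using \<sigma>0 by eventually_elim (simp add: mult.left_commute)
    qed
    then show ?thesis by (simp add: L2_inner_def)
  qed
  \<comment> \<open>Strong monotonicity between \<open>H\<close> and 0, with the adjoint relation tested with \<open>v = H\<close>.\<close>
  have energy: "\<alpha> * ?x\<^sup>2 + L2_inner \<Omega> a ?s \<le> b * T * ?x + d * T\<^sup>2"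
  proof -
    have "\<alpha> * ?x\<^sup>2 = L2_inner \<Omega> (\<lambda>x. \<alpha> *\<^sub>R H x) H"
      by (simp add: L2_norm_power2) (simp add: L2_inner_def)
    also have "\<dots> \<le> L2_inner \<Omega> (\<lambda>x. g' (H x) - g' 0) H"
      using mono[of _ 0] by (intro L2_inner_mono L2_scaleR L2_diff HL gL cL AE_I2) (simp add: power2_norm_eq_inner)
    also have "\<dots> = L2_inner \<Omega> ?g H - L2_inner \<Omega> (\<lambda>x. g' 0) H"
      by (rule L2_inner_diff_left[OF gL cL HL])
    also have "L2_inner \<Omega> ?g H = L2_inner \<Omega> a (\<lambda>x. j x - \<sigma> x * a x)"
      using adj HL rL wc by (simp add: curl_adjoint_def)
    also have "\<dots> = L2_inner \<Omega> a j - L2_inner \<Omega> a ?s" by (rule L2_inner_diff_right[OF j sL aL])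
    finally have "\<alpha> * ?x\<^sup>2 + L2_inner \<Omega> a ?s \<le> L2_inner \<Omega> a j - L2_inner \<Omega> (\<lambda>x. g' 0) H" by simp
    also have "\<dots> \<le> L2_norm \<Omega> a * ?J + L2_norm \<Omega> (\<lambda>x. g' 0) * ?x"
      using L2_Cauchy_Schwarz[OF op bd aL j] L2_Cauchy_Schwarz[OF op bd cL HL] by linarith
    also have "\<dots> \<le> (c * (C\<^sub>a * ?x + \<mu> * T)) * T + (\<mu> * T) * ?x"
      using na G T x J c C\<^sub>a \<mu> by (intro add_mono mult_mono) auto
    also have "\<dots> = b * T * ?x + d * T\<^sup>2"
      by (simp add: b_def d_def algebra_simps power2_eq_square)
    finally show ?thesis .
  qed
  then have "\<alpha> * ?x\<^sup>2 \<le> b * T * ?x + d * T\<^sup>2" using s0 by linarith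
  then show H: "?x \<le> K * T" unfolding K_def by (rule quadratic_bound[OF \<alpha> x T(1) b d])
  have "c * (C\<^sub>a * ?x + \<mu> * T) \<le> c * (C\<^sub>a * (K * T) + \<mu> * T)"
    using H c C\<^sub>a by (intro mult_left_mono add_right_mono) auto
  then show "L2_norm \<Omega> a \<le> c * (C\<^sub>a * K + \<mu>) * T"
    using na by (simp add: algebra_simps)
  have K: "K \<ge> 0" using b d \<alpha> by (simp add: K_def)
  have s: "L2_inner \<Omega> a ?s \<le> (b * K + d) * T\<^sup>2"
  proof -
    have "L2_inner \<Omega> a ?s \<le> b * T * ?x + d * T\<^sup>2"
      using energy \<alpha> zero_le_power2[of ?x] by (smt (verit) mult_nonneg_nonneg)
    also have "\<dots> \<le> b * T * (K * T) + d * T\<^sup>2"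
      using H b T by (intro add_right_mono mult_left_mono) auto
    finally show ?thesis by (simp add: algebra_simps power2_eq_square)
  qed
  let ?S = "Linf_norm \<Omega> \<sigma>"
  have S: "?S \<ge> 0" by (rule Linf_norm_bound(1)[OF \<sigma>])
  have "(L2_norm \<Omega> ?s)\<^sup>2 \<le> L2_inner \<Omega> (\<lambda>x. ?S *\<^sub>R a x) ?s"
    unfolding L2_norm_power2
  proof (intro L2_inner_mono sL L2_scaleR aL)
    show "AE x in lebesgue_on \<Omega>. ?s x \<bullet> ?s x \<le> (?S *\<^sub>R a x) \<bullet> ?s x"
      using Linf_norm_bound(2)[OF \<sigma>] \<sigma>0
    proof eventually_elim
      fix x assume "\<bar>\<sigma> x\<bar> \<le> ?S" "0 \<le> \<sigma> x"
      then have "\<sigma> x * (\<sigma> x * (a x)\<^sup>2) \<le> ?S * (\<sigma> x * (a x)\<^sup>2)" by (intro mult_right_mono) auto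
      then show "?s x \<bullet> ?s x \<le> (?S *\<^sub>R a x) \<bullet> ?s x"
        by (simp add: power2_eq_square mult_ac)
    qed
  qed
  also have "\<dots> = ?S * L2_inner \<Omega> a ?s" by (simp add: L2_inner_def mult.assoc)
  also have "\<dots> \<le> ?S * ((b * K + d) * T\<^sup>2)" by (intro mult_left_mono s S)
  also have "\<dots> = (sqrt ?S * sqrt (b * K + d) * T)\<^sup>2"
    using S b K d by (simp add: power_mult_distrib)
  finally have ns: "L2_norm \<Omega> ?s \<le> sqrt ?S * sqrt (b * K + d) * T"
    by (rule power2_le_imp_le) (use S b K d T in simp)
  have "L2_norm \<Omega> (curl \<Omega> H) = L2_norm \<Omega> (\<lambda>x. j x - \<sigma> x * a x)"
    using curl_AE_eq[OF op bd HL rL wc] HcurlD[OF op bd] rL by (intro L2_norm_cong_AE) auto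
  also have "\<dots> \<le> ?J + L2_norm \<Omega> ?s" by (rule L2_norm_triangle_diff[OF op bd j sL])
  also have "\<dots> \<le> (1 + sqrt ?S * sqrt (b * K + d)) * T"
    using ns T by (simp add: distrib_right)
  finally show "L2_norm \<Omega> (curl \<Omega> H) \<le> (1 + sqrt ?S * sqrt (b * K + d)) * T" .
qed

end

end

theorem lemma2:
  fixes \<Omega> :: "(real^2) set" and \<alpha> C\<^sub>a :: real
  assumes "polygonal_lipschitz_domain \<Omega>" and "simply_connected \<Omega>"
    and "\<alpha> > 0" and "C\<^sub>a > 0"
  shows "\<exists>C. \<forall>(\<sigma> :: real^2 \<Rightarrow> real) (g :: real^2 \<Rightarrow> real) (g' :: real^2 \<Rightarrow> real^2) (j :: real^2 \<Rightarrow> real).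
    \<sigma> \<in> Linf \<Omega> \<and> (AE x in lebesgue_on \<Omega>. \<sigma> x \<ge> 0) \<and>
    (\<forall>y. GDERIV g y :> g' y) \<and> Ck 1 g' \<and>
    (\<forall>y z. (g' y - g' z) \<bullet> (y - z) \<ge> \<alpha> * (norm (y - z))\<^sup>2) \<and>
    (\<forall>y z. norm (g' y - g' z) \<le> C\<^sub>a * norm (y - z)) \<and>
    j \<in> L2 \<Omega> \<longrightarrow>
      (\<exists>H a. mixed_solution \<Omega> \<sigma> g' j H a) \<and>
      (\<forall>H a H' a'. mixed_solution \<Omega> \<sigma> g' j H a \<and> mixed_solution \<Omega> \<sigma> g' j H' a' \<longrightarrow>
         (AE x in lebesgue_on \<Omega>. H x = H' x \<and> a x = a' x)) \<and>
      (\<forall>H a. mixed_solution \<Omega> \<sigma> g' j H a \<longrightarrow>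
         L2_norm \<Omega> H + L2_norm \<Omega> a \<le> C * (L2_norm \<Omega> j + norm (g' 0)) \<and>
         Hcurl_norm \<Omega> H + L2_norm \<Omega> a
           \<le> C * (1 + sqrt (Linf_norm \<Omega> \<sigma>)) * (L2_norm \<Omega> j + norm (g' 0)))"
proof -
  have op: "open \<Omega>" and bd: "bounded \<Omega>" using assms(1) by (auto simp: polygonal_lipschitz_domain_def)
  obtain c where cb: "curl_inverse_bound \<Omega> c"
    using curl_bounded_right_inverse[OF op bd] unfolding curl_inverse_bound_def by blast
  then have c: "c > 0" by (simp add: curl_inverse_bound_def)
  define \<mu> where "\<mu> = sqrt (measure lebesgue \<Omega>)"
  define b where "b = c * C\<^sub>a + \<mu>"
  define d where "d = c * \<mu>"
  define K where "K = (b + d) / \<alpha> + 1"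
  define Q where "Q = sqrt (b * K + d)"
  define C where "C = K + c * (C\<^sub>a * K + \<mu>) + 1 + Q"
  have \<mu>: "\<mu> \<ge> 0" by (simp add: \<mu>_def)
  have b: "b \<ge> 0" and d: "d \<ge> 0" using c assms \<mu> by (auto simp: b_def d_def)
  have K: "K \<ge> 0" using b d assms by (simp add: K_def)
  have Q: "Q \<ge> 0" using b d K by (simp add: Q_def)
  show ?thesis
  proof (intro exI[of _ C] allI impI, elim conjE)
    fix \<sigma> :: "real^2 \<Rightarrow> real" and g :: "real^2 \<Rightarrow> real" and g' :: "real^2 \<Rightarrow> real^2" and j :: "real^2 \<Rightarrow> real"
    assume \<sigma>: "\<sigma> \<in> Linf \<Omega>" "AE x in lebesgue_on \<Omega>. \<sigma> x \<ge> 0"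
      and mono: "\<forall>y z. (g' y - g' z) \<bullet> (y - z) \<ge> \<alpha> * (norm (y - z))\<^sup>2"
      and lip: "\<forall>y z. norm (g' y - g' z) \<le> C\<^sub>a * norm (y - z)"
      and j: "j \<in> L2 \<Omega>"
    note hyps = op bd cb assms(3,4) \<sigma> mono[rule_format] lip[rule_format] j
    let ?T = "L2_norm \<Omega> j + norm (g' 0)" and ?S = "sqrt (Linf_norm \<Omega> \<sigma>)"
    have T: "?T \<ge> 0" by (simp add: L2_norm_nonneg)
    have S: "?S \<ge> 0" using Linf_norm_bound(1)[OF \<sigma>(1)] by simp
    have bounds: "L2_norm \<Omega> H + L2_norm \<Omega> a \<le> C * ?T \<and> Hcurl_norm \<Omega> H + L2_norm \<Omega> a \<le> C * (1 + ?S) * ?T"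
      if sol: "mixed_solution \<Omega> \<sigma> g' j H a" for H a
    proof -
      note est = mixed_solution_bounds[OF hyps sol, folded \<mu>_def, folded b_def d_def, folded K_def, folded Q_def]
      have "L2_norm \<Omega> H + L2_norm \<Omega> a \<le> (K + c * (C\<^sub>a * K + \<mu>)) * ?T"
        using est(1,2) by (simp add: distrib_right)
      also have "\<dots> \<le> C * ?T" using T Q by (intro mult_right_mono) (auto simp: C_def)
      finally have 1: "L2_norm \<Omega> H + L2_norm \<Omega> a \<le> C * ?T" .
      have "Hcurl_norm \<Omega> H \<le> L2_norm \<Omega> H + L2_norm \<Omega> (curl \<Omega> H)"
        unfolding Hcurl_norm_def by (intro sqrt_sum_squares_le_sum L2_norm_nonneg)
      then have "Hcurl_norm \<Omega> H + L2_norm \<Omega> a \<le> (K + c * (C\<^sub>a * K + \<mu>) + 1 + ?S * Q) * ?T"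
        using est by (simp add: distrib_right)
      also have "\<dots> \<le> (C * (1 + ?S)) * ?T"
      proof (rule mult_right_mono[OF _ T])
        have "0 \<le> (K + c * (C\<^sub>a * K + \<mu>) + 1) * ?S + Q"
          using K c assms \<mu> S Q by (intro add_nonneg_nonneg mult_nonneg_nonneg) auto
        then show "K + c * (C\<^sub>a * K + \<mu>) + 1 + ?S * Q \<le> C * (1 + ?S)"
          by (simp add: C_def algebra_simps)
      qed
      finally show ?thesis using 1 by simp
    qed
    show "(\<exists>H a. mixed_solution \<Omega> \<sigma> g' j H a) \<and>
      (\<forall>H a H' a'. mixed_solution \<Omega> \<sigma> g' j H a \<and> mixed_solution \<Omega> \<sigma> g' j H' a' \<longrightarrow>
         (AE x in lebesgue_on \<Omega>. H x = H' x \<and> a x = a' x)) \<and>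
      (\<forall>H a. mixed_solution \<Omega> \<sigma> g' j H a \<longrightarrow>
         L2_norm \<Omega> H + L2_norm \<Omega> a \<le> C * ?T \<and>
         Hcurl_norm \<Omega> H + L2_norm \<Omega> a \<le> C * (1 + ?S) * ?T)"
      using mixed_solution_exists[OF hyps] mixed_solution_unique[OF hyps] bounds by blast
  qed
qed

end
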